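(* Let $d=1$ and $1<p<q<5$. If $M'(0)\in[-\infty,0)$, then there exists $\psi\in H^1_{\mathrm{rad}}(\mathbb{R})$ such that $$(\psi,\phi_0)_{L^2}=0\quad\text{and}\quad \langle L_0\psi,\psi\rangle<0 .$$
   Context: For $\omega\ge 0$, $\phi_\omega$ denotes the unique positive, even, decreasing (and decaying to $0$ at infinity) solution on $\mathbb{R}$ of $-\phi''+\omega\phi+|\phi|^{p-1}\phi-|\phi|^{q-1}\phi=0$. For $p<5$ one has $\phi_0\in H^1(\mathbb{R})$. For $\omega>0$, $M(\omega):=\frac12\|\phi_\omega\|_{L^2}^2$, and $M'(0):=\lim_{\omega\downarrow0}M'(\omega)$; it is known that this limit exists in $[-\infty,\infty)$. The operator $L_0=-\partial_x^2+p\phi_0^{p-1}-q\phi_0^{q-1}$ acts on real-valued functions of $H^1(\mathbb{R})$, with quadratic form $\langle L_0\psi,\psi\rangle=\int_{\mathbb{R}}\bigl(|\psi'|^2+p\phi_0^{p-1}\psi^2-q\phi_0^{q-1}\psi^2\bigr)\,dx$ (so $\psi$ is real-valued). $H^1_{\mathrm{rad}}(\mathbb{R})$ is the space of even functions in $H^1(\mathbb{R})$. *)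

theory Defs
  imports "HOL-Analysis.Analysis"
begin

text \<open>The double-power equation is understood classically; since the nonlinearity is
  continuous, a twice differentiable solution is automatically of class \<open>C\<^sup>2\<close>.
  An even function is called decreasing if it is strictly decreasing in \<open>\<bar>x\<bar>\<close>.\<close>

definition solves_double_power :: "real \<Rightarrow> real \<Rightarrow> real \<Rightarrow> (real \<Rightarrow> real) \<Rightarrow> bool" where
  "solves_double_power p q \<omega> \<phi> \<longleftrightarrow>
     \<phi> differentiable_on UNIV \<and> deriv \<phi> differentiable_on UNIV \<and>
     (\<forall>x. - deriv (deriv \<phi>) x + \<omega> * \<phi> x
          + \<bar>\<phi> x\<bar> powr (p - 1) * \<phi> x - \<bar>\<phi> x\<bar> powr (q - 1) * \<phi> x = 0)"

definition ground_state :: "real \<Rightarrow> real \<Rightarrow> real \<Rightarrow> (real \<Rightarrow> real) \<Rightarrow> bool" where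
  "ground_state p q \<omega> \<phi> \<longleftrightarrow>
     solves_double_power p q \<omega> \<phi> \<and>
     (\<forall>x. \<phi> x > 0) \<and> (\<forall>x. \<phi> (- x) = \<phi> x) \<and>
     (\<forall>x y. 0 \<le> x \<longrightarrow> x < y \<longrightarrow> \<phi> y < \<phi> x) \<and> (\<phi> \<longlongrightarrow> 0) at_infinity"

definition mass :: "(real \<Rightarrow> real) \<Rightarrow> real" where
  "mass u = 1 / 2 * (LINT x|lborel. (u x)\<^sup>2)"

definition L2_inner :: "(real \<Rightarrow> real) \<Rightarrow> (real \<Rightarrow> real) \<Rightarrow> real" where
  "L2_inner u v = (LINT x|lborel. u x * v x)"

text \<open>Elements of \<open>L\<^sup>2\<close> and \<open>H\<^sup>1\<close> are represented by Borel functions rather than by classes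
  modulo null sets; a class is even iff it has a representative that is even everywhere.\<close>

definition L2 :: "(real \<Rightarrow> real) set" where
  "L2 = {u. u \<in> borel_measurable lborel \<and> integrable lborel (\<lambda>x. (u x)\<^sup>2)}"

definition test_function :: "(real \<Rightarrow> real) \<Rightarrow> bool" where
  "test_function \<eta> \<longleftrightarrow>
     (\<forall>n. (deriv ^^ n) \<eta> differentiable_on UNIV) \<and> (\<exists>R. \<forall>x. \<bar>x\<bar> > R \<longrightarrow> \<eta> x = 0)"

definition has_L2_weak_derivative :: "(real \<Rightarrow> real) \<Rightarrow> (real \<Rightarrow> real) \<Rightarrow> bool" where
  "has_L2_weak_derivative u u' \<longleftrightarrow>
     u' \<in> L2 \<and>
     (\<forall>\<eta>. test_function \<eta> \<longrightarrow>
        (LINT x|lborel. u x * deriv \<eta> x) = - (LINT x|lborel. u' x * \<eta> x))"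

definition H1 :: "(real \<Rightarrow> real) set" where
  "H1 = {u \<in> L2. \<exists>u'. has_L2_weak_derivative u u'}"

definition H1_rad :: "(real \<Rightarrow> real) set" where
  "H1_rad = {u \<in> H1. \<forall>x. u (- x) = u x}"

text \<open>The form \<open>\<langle>L\<^sub>0 \<psi>, \<psi>\<rangle>\<close>, with the weak derivative \<open>\<psi>'\<close> of \<open>\<psi>\<close> as an explicit argument: it
  is determined by \<open>\<psi>\<close> up to a null set, so the value depends on \<open>\<psi>\<close> only.\<close>

definition L0_form ::
  "real \<Rightarrow> real \<Rightarrow> (real \<Rightarrow> real) \<Rightarrow> (real \<Rightarrow> real) \<Rightarrow> (real \<Rightarrow> real) \<Rightarrow> real" where
  "L0_form p q \<phi>0 \<psi> \<psi>' =
     (LINT x|lborel. \<bar>\<psi>' x\<bar>\<^sup>2 + p * \<phi>0 x powr (p - 1) * (\<psi> x)\<^sup>2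
                      - q * \<phi>0 x powr (q - 1) * (\<psi> x)\<^sup>2)"

end

theory Submission
  imports Defs
begin

text \<open>
  Write \<open>f = \<phi>\<^sub>0\<close>, \<open>N = \<parallel>f\<parallel>\<^sup>2\<close> and \<open>V = p f\<^sup>p\<^sup>-\<^sup>1 - q f\<^sup>q\<^sup>-\<^sup>1\<close>. Since \<open>L\<^sub>0 f' = 0\<close>, the form at \<open>c f + k f'\<close>
  with \<open>k\<close> odd depends on \<open>k\<close> only through \<open>k'\<close>. The first integral gives \<open>f\<close> an explicit weight \<open>\<rho>\<close> for which
  \<open>k' = \<rho> + \<gamma>\<close> and \<open>c = c\<^sub>0\<close> solve \<open>L\<^sub>0 \<psi> = - 2 \<kappa> f\<close>. Cutting \<open>k'\<close> off at \<open>\<bar>x\<bar> = R\<close>, which keeps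
  \<open>\<psi>\<close> in \<open>H\<^sup>1\<close>, and choosing \<open>c\<close> so that \<open>\<psi>\<close> is orthogonal to \<open>f\<close>, the form becomes
  \<open>(c - c\<^sub>0)\<^sup>2 \<langle>L\<^sub>0 f, f\<rangle> - 2 \<kappa> N (c - c\<^sub>0)\<close> up to an error that vanishes as \<open>R \<rightarrow> \<infinity>\<close>. So \<open>\<psi>\<close> is a
  negative direction unless \<open>\<integral> f\<^sup>2 (\<rho> + \<gamma>) \<le> 2 c\<^sub>0 N\<close>.

  In that remaining case \<open>M'(0) < 0\<close> fails. With \<open>\<theta> = \<phi>\<^sub>\<omega>(0) / f(0)\<close>, matching the points where \<open>\<phi>\<^sub>\<omega> = \<theta> f\<close>
  turns \<open>M(\<omega>)\<close> into half the integral of \<open>\<theta>\<^sup>2 f\<^sup>2 / sqrt z\<close> with \<open>z = \<theta>\<^sup>p\<^sup>-\<^sup>1 + (\<theta>\<^sup>q\<^sup>-\<^sup>1 - \<theta>\<^sup>p\<^sup>-\<^sup>1) \<rho>\<close>.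
  Convexity of \<open>1 / sqrt z\<close> bounds this below, by the assumption on \<open>\<rho>\<close>, by a function of \<open>\<theta>\<close> that equals \<open>M(0)\<close>
  at \<open>\<theta> = 1\<close> with vanishing derivative, whereas \<open>M'(0) < 0\<close> forces a linear decrease in \<open>\<omega> \<sim> \<theta> - 1\<close>.
\<close>

section \<open>Square-integrable functions on the line\<close>

lemma L2_mult_integrable:
  assumes "u \<in> L2" "v \<in> L2"
  shows "integrable lborel (\<lambda>x. u x * v x)"
proof (rule Bochner_Integration.integrable_bound)
  show "integrable lborel (\<lambda>x. (u x)\<^sup>2 + (v x)\<^sup>2)"
    using assms by (auto simp: L2_def)
  show "(\<lambda>x. u x * v x) \<in> borel_measurable lborel"
    using assms by (auto simp: L2_def)
  have "\<bar>a * b\<bar> \<le> a\<^sup>2 + b\<^sup>2" for a b :: real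
    using sum_squares_bound[of a b] sum_squares_bound[of a "- b"] by (auto simp: abs_if)
  then show "AE x in lborel. norm (u x * v x) \<le> norm ((u x)\<^sup>2 + (v x)\<^sup>2)"
    by (intro AE_I2) (simp only: real_norm_def abs_of_nonneg[OF add_nonneg_nonneg[OF zero_le_power2 zero_le_power2]])
qed

lemma L2_add:
  assumes "u \<in> L2" "v \<in> L2"
  shows "(\<lambda>x. u x + v x) \<in> L2"
  using assms L2_mult_integrable[OF assms] by (auto simp: L2_def power2_sum mult.assoc)

lemma L2_bounded_mult:
  assumes "u \<in> L2" "h \<in> borel_measurable borel" "\<And>x. \<bar>h x\<bar> \<le> C"
  shows "(\<lambda>x. h x * u x) \<in> L2"
proof -
  have "integrable lborel (\<lambda>x. (h x * u x)\<^sup>2)"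
  proof (rule Bochner_Integration.integrable_bound)
    show "integrable lborel (\<lambda>x. C\<^sup>2 * (u x)\<^sup>2)"
      using assms by (auto simp: L2_def)
    show "(\<lambda>x. (h x * u x)\<^sup>2) \<in> borel_measurable lborel"
      using assms by (auto simp: L2_def)
    have "(h x)\<^sup>2 \<le> C\<^sup>2" for x
      using power_mono[OF assms(3) abs_ge_zero, of x 2] by simp
    then show "AE x in lborel. norm ((h x * u x)\<^sup>2) \<le> norm (C\<^sup>2 * (u x)\<^sup>2)"
      by (intro AE_I2) (simp add: power_mult_distrib mult_right_mono)
  qed
  with assms show ?thesis by (auto simp: L2_def)
qed

lemma L2_continuous_bounded_mult:
  assumes "u \<in> L2" "continuous_on UNIV h" "\<And>x. \<bar>h x\<bar> \<le> C"
  shows "(\<lambda>x. h x * u x) \<in> L2"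
  using assms by (intro L2_bounded_mult borel_measurable_continuous_onI)

lemma L2_continuous_compact_support:
  assumes cont: "continuous_on UNIV u" and supp: "\<And>x. R < \<bar>x\<bar> \<Longrightarrow> u x = 0"
  shows "u \<in> L2"
proof -
  have "integrable lborel (\<lambda>x. indicator {- R..R} x *\<^sub>R (u x)\<^sup>2)"
    by (rule borel_integrable_compact) (auto intro!: continuous_intros continuous_on_subset[OF cont])
  also have "(\<lambda>x. indicator {- R..R} x *\<^sub>R (u x)\<^sup>2) = (\<lambda>x. (u x)\<^sup>2)"
    using supp by (intro ext) (metis abs_le_iff atLeastAtMost_iff indicator_simps minus_le_iff mult_eq_0_iff
        not_le power2_eq_square real_scaleR_def scaleR_one scaleR_zero_left)
  finally show ?thesis
    using borel_measurable_continuous_onI[OF cont] by (auto simp: L2_def)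
qed

section \<open>Integrals over the line as limits over growing intervals, and integration by
  parts\<close>

lemma integrable_tendsto_symmetric_intervals:
  fixes g :: "real \<Rightarrow> real"
  assumes "integrable lborel g"
  shows "(\<lambda>n. integral {- real n..real n} g) \<longlonglongrightarrow> (LINT x|lborel. g x)"
proof -
  have "(\<lambda>n. LINT x|lborel. indicator {- real n..real n} x *\<^sub>R g x) \<longlonglongrightarrow> (LINT x|lborel. g x)"
  proof (rule integral_dominated_convergence)
    show "integrable lborel (\<lambda>x. norm (g x))" using assms by simp
    show "AE x in lborel. (\<lambda>n. indicator {- real n..real n} x *\<^sub>R g x) \<longlonglongrightarrow> g x"
    proof (intro AE_I2 tendsto_eventually)
      fix x :: real
      have "x \<in> {- real n..real n}" if "n \<ge> nat \<lceil>\<bar>x\<bar>\<rceil>" for n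
        using that by (auto simp: abs_le_iff nat_le_iff ceiling_le_iff)
      then show "\<forall>\<^sub>F n in sequentially. indicator {- real n..real n} x *\<^sub>R g x = g x"
        unfolding eventually_sequentially by (intro exI[of _ "nat \<lceil>\<bar>x\<bar>\<rceil>"]) auto
    qed
  qed (use assms in \<open>auto simp: indicator_def\<close>)
  moreover have "(LINT x|lborel. indicator {- real n..real n} x *\<^sub>R g x) = integral {- real n..real n} g" for n
    using set_borel_integral_eq_integral(2)[of "{- real n..real n}" g] integrable_mult_indicator[OF _ assms]
    by (simp add: set_integrable_def set_lebesgue_integral_def)
  ultimately show ?thesis by simp
qed

text \<open>The exceptional points allow for the corners of the trial functions at
  \<open>- R\<close> and \<open>R\<close>, and for \<open>Z\<close>, whose derivative is computed
  only off 0.\<close>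

lemma has_integral_FTC_finite_exceptions:
  fixes g T :: "real \<Rightarrow> real"
  assumes "finite S" "a \<le> b" "continuous_on {a..b} T"
    and "\<And>x. a < x \<Longrightarrow> x < b \<Longrightarrow> x \<notin> S \<Longrightarrow> (T has_real_derivative g x) (at x)"
  shows "(g has_integral (T b - T a)) {a..b}"
  using assms by (intro fundamental_theorem_of_calculus_interior_strong[of S])
    (auto simp: has_real_derivative_iff_has_vector_derivative)

text \<open>Each integration by parts over the whole line is an instance of this: \<open>T\<close>
  is the product that is differentiated, and its boundary values vanish in the limit.\<close>

lemma lebesgue_integral_derivative_vanishing_at_infinity:
  fixes g T :: "real \<Rightarrow> real"
  assumes "finite S" "continuous_on UNIV T"
    and "\<And>x. x \<notin> S \<Longrightarrow> (T has_real_derivative g x) (at x)"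
    and "integrable lborel g" "(T \<longlongrightarrow> 0) at_infinity"
  shows "(LINT x|lborel. g x) = 0"
proof -
  have eq: "integral {- real n..real n} g = T (real n) - T (- real n)" for n
    using assms(1-3) by (intro integral_unique has_integral_FTC_finite_exceptions[of S])
      (auto intro: continuous_on_subset)
  have top: "filterlim real at_infinity sequentially" "filterlim (\<lambda>n. - real n) at_infinity sequentially"
    by (simp_all add: filterlim_at_top_imp_at_infinity filterlim_at_bot_imp_at_infinity filterlim_real_sequentially
      filterlim_uminus_at_bot)
  have "(\<lambda>n. T (real n) - T (- real n)) \<longlonglongrightarrow> 0 - 0"
    by (intro tendsto_diff filterlim_compose[OF assms(5)] top)
  with integrable_tendsto_symmetric_intervals[OF assms(4)] show ?thesis
    unfolding eq using LIMSEQ_unique by fastforce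
qed

text \<open>The derivative of \<open>u * \<eta>\<close> integrates to zero because
  \<open>\<eta>\<close> has compact support. Continuity of \<open>u\<close> across \<open>S\<close>
  rules out point masses, so the pointwise derivative is the weak one.\<close>

lemma has_L2_weak_derivativeI:
  assumes "finite S" and cont: "continuous_on UNIV u"
    and deriv: "\<And>x. x \<notin> S \<Longrightarrow> (u has_real_derivative u' x) (at x)"
    and "u \<in> L2" "u' \<in> L2"
  shows "has_L2_weak_derivative u u'"
  unfolding has_L2_weak_derivative_def
proof (intro conjI allI impI \<open>u' \<in> L2\<close>)
  fix \<eta> assume \<eta>: "test_function \<eta>"
  have diff: "(deriv ^^ n) \<eta> differentiable_on UNIV" for n
    using \<eta> by (simp add: test_function_def)
  obtain R where R: "\<And>x. R < \<bar>x\<bar> \<Longrightarrow> \<eta> x = 0"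
    using \<eta> unfolding test_function_def by auto
  have d\<eta>: "(\<eta> has_real_derivative deriv \<eta> x) (at x)" for x
  proof -
    have "\<eta> field_differentiable at x"
      using diff[of 0] unfolding differentiable_on_def
      by (simp add: real_differentiable_def field_differentiable_def)
    then show ?thesis
      by (simp add: DERIV_deriv_iff_field_differentiable)
  qed
  \<comment> \<open>The support bound passes to the derivative because \<open>\<eta>\<close>
    vanishes on a whole neighbourhood of \<open>x\<close>.\<close>
  have R': "deriv \<eta> x = 0" if "R < \<bar>x\<bar>" for x
  proof -
    have "open {x. R < \<bar>x\<bar>}"
      by (intro open_Collect_less continuous_intros)
    then have "((\<lambda>x. 0) has_real_derivative deriv \<eta> x) (at x)"
      by (rule has_field_derivative_transform_within_open[OF d\<eta>]) (use that in \<open>simp_all add: R\<close>)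
    then show ?thesis
      using DERIV_unique DERIV_const by blast
  qed
  have c\<eta>: "continuous_on UNIV \<eta>" "continuous_on UNIV (deriv \<eta>)"
    using diff[of 0] diff[of 1] by (auto intro: differentiable_imp_continuous_on)
  have int: "integrable lborel (\<lambda>x. u x * deriv \<eta> x)" "integrable lborel (\<lambda>x. u' x * \<eta> x)"
    using assms L2_continuous_compact_support[OF c\<eta>(1) R] L2_continuous_compact_support[OF c\<eta>(2) R']
    by (auto intro!: L2_mult_integrable)
  have "\<forall>\<^sub>F x in at_infinity. u x * \<eta> x = 0"
    unfolding eventually_at_infinity using R by (intro exI[of _ "R + 1"]) auto
  then have lim: "((\<lambda>x. u x * \<eta> x) \<longlongrightarrow> 0) at_infinity"
    by (rule tendsto_eventually)
  have "(LINT x|lborel. u x * deriv \<eta> x + u' x * \<eta> x) = 0"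
    by (rule lebesgue_integral_derivative_vanishing_at_infinity[OF \<open>finite S\<close> _ _ _ lim])
      (use int d\<eta> in \<open>auto intro!: continuous_intros cont c\<eta> derivative_eq_intros deriv\<close>)
  then show "(LINT x|lborel. u x * deriv \<eta> x) = - (LINT x|lborel. u' x * \<eta> x)"
    using int by simp
qed

section \<open>Even functions on the line and odd primitives\<close>

lemma integral_symmetric_interval_even:
  fixes f :: "real \<Rightarrow> real"
  assumes cont: "continuous_on UNIV f" and even: "\<And>x. f (- x) = f x" and "0 \<le> X"
  shows "integral {- X..X} f = 2 * integral {0..X} f"
proof -
  have int: "f integrable_on {a..b}" for a b
    using cont by (intro integrable_continuous_real) (auto intro: continuous_on_subset)
  have "integral {- X..X} f = integral {- X..0} f + integral {0..X} f"
    using int \<open>0 \<le> X\<close> by (subst Henstock_Kurzweil_Integration.integral_combine) auto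
  moreover have "integral {- X..0} f = integral {0..X} f"
    using Henstock_Kurzweil_Integration.integral_reflect_real[of X 0 f] even by simp
  ultimately show ?thesis by simp
qed

text \<open>Monotone convergence along the truncations to \<open>{- real n..real n}\<close>;
  evenness doubles the bound on the half-line.\<close>

lemma integrable_even_of_bounded_integrals:
  fixes f :: "real \<Rightarrow> real"
  assumes cont: "continuous_on UNIV f" and even: "\<And>x. f (- x) = f x" and nonneg: "\<And>x. 0 \<le> f x"
    and bound: "\<And>X. 0 \<le> X \<Longrightarrow> integral {0..X} f \<le> B"
  shows "integrable lborel f"
proof -
  define F where "F n x = indicator {- real n..real n} x *\<^sub>R f x" for n x
  have F: "integrable lborel (F n)" "(LINT x|lborel. F n x) = integral {- real n..real n} f" for n
  proof -
    show "integrable lborel (F n)"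
      unfolding F_def by (rule borel_integrable_compact) (auto intro: continuous_on_subset[OF cont])
    then show "(LINT x|lborel. F n x) = integral {- real n..real n} f"
      unfolding F_def using set_borel_integral_eq_integral(2)[of "{- real n..real n}" f]
      by (simp add: set_integrable_def set_lebesgue_integral_def)
  qed
  have mono: "mono (\<lambda>n. F n x)" for x
    using nonneg by (intro monoI) (auto simp: F_def indicator_def)
  have "mono (\<lambda>n. LINT x|lborel. F n x)"
    using mono F by (intro monoI integral_mono) (auto simp: mono_def)
  moreover have "(LINT x|lborel. F n x) \<le> 2 * B" for n
    unfolding F using bound[of "real n"] integral_symmetric_interval_even[OF cont even, of "real n"] by simp
  ultimately obtain L where "(\<lambda>n. LINT x|lborel. F n x) \<longlonglongrightarrow> L"
    using incseq_convergent[of "\<lambda>n. LINT x|lborel. F n x" "2 * B"] by blast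
  moreover have "(\<lambda>n. F n x) \<longlonglongrightarrow> f x" for x
  proof (rule tendsto_eventually)
    have "x \<in> {- real n..real n}" if "n \<ge> nat \<lceil>\<bar>x\<bar>\<rceil>" for n
      using that by (auto simp: abs_le_iff nat_le_iff ceiling_le_iff)
    then show "\<forall>\<^sub>F n in sequentially. F n x = f x"
      unfolding eventually_sequentially F_def by (intro exI[of _ "nat \<lceil>\<bar>x\<bar>\<rceil>"]) auto
  qed
  ultimately show ?thesis
    using mono F borel_measurable_continuous_onI[OF cont]
    by (intro integrable_monotone_convergence[of lborel F f L]) auto
qed

lemma integral_interval_le_lebesgue_integral_even:
  fixes f :: "real \<Rightarrow> real"
  assumes cont: "continuous_on UNIV f" and even: "\<And>x. f (- x) = f x" and nonneg: "\<And>x. 0 \<le> f x"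
    and int: "integrable lborel f" and "0 \<le> X"
  shows "2 * integral {0..X} f \<le> (LINT x|lborel. f x)"
proof -
  have "2 * integral {0..X} f = integral {- X..X} f"
    using integral_symmetric_interval_even[OF cont even \<open>0 \<le> X\<close>] by simp
  also have "\<dots> = (LINT x|lborel. indicator {- X..X} x *\<^sub>R f x)"
    using set_borel_integral_eq_integral(2)[of "{- X..X}" f] integrable_mult_indicator[OF _ int]
    by (simp add: set_integrable_def set_lebesgue_integral_def)
  also have "\<dots> \<le> (LINT x|lborel. f x)"
    using nonneg by (intro integral_mono integrable_mult_indicator int) (auto simp: indicator_def)
  finally show ?thesis .
qed

lemma tendsto_integral_interval_even:
  fixes f :: "real \<Rightarrow> real"
  assumes cont: "continuous_on UNIV f" and even: "\<And>x. f (- x) = f x" and int: "integrable lborel f"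
  shows "(\<lambda>n. 2 * integral {0..real n} f) \<longlonglongrightarrow> (LINT x|lborel. f x)"
  using integrable_tendsto_symmetric_intervals[OF int] integral_symmetric_interval_even[OF cont even]
  by simp

lemma lebesgue_integral_interval_continuous:
  fixes h :: "real \<Rightarrow> real"
  assumes "continuous_on {a..b} h"
  shows "integrable lborel (\<lambda>x. indicator {a..b} x * h x)"
    and "(LINT x|lborel. indicator {a..b} x * h x) = integral {a..b} h"
proof -
  show int: "integrable lborel (\<lambda>x. indicator {a..b} x * h x)"
    using borel_integrable_compact[of "{a..b}" h] assms by simp
  then show "(LINT x|lborel. indicator {a..b} x * h x) = integral {a..b} h"
    using set_borel_integral_eq_integral(2)[of "{a..b}" h]
    by (simp add: set_integrable_def set_lebesgue_integral_def)
qed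

text \<open>Supplies the factor \<open>k\<close> of the trial function \<open>c f + k f'\<close>.
  Freezing the primitive outside \<open>[- R, R]\<close> keeps it bounded at the price of two
  corners, and oddness makes \<open>k f'\<close> even.\<close>

lemma odd_primitive:
  fixes s :: "real \<Rightarrow> real"
  assumes cont: "continuous_on UNIV s" and even: "\<And>x. s (- x) = s x" and "0 < R"
  obtains k C where "continuous_on UNIV k" "\<And>x. k (- x) = - k x" "\<And>x. \<bar>k x\<bar> \<le> C"
    "\<And>x. \<bar>x\<bar> \<noteq> R \<Longrightarrow> (k has_real_derivative indicator {- R..R} x * s x) (at x)"
proof -
  \<comment> \<open>The margin 1 makes \<open>- R\<close> and \<open>R\<close> interior points, so
    that the derivative there is two-sided.\<close>
  obtain G where G: "\<And>x. x \<in> {- (R + 1)..R + 1} \<Longrightarrow> (G has_vector_derivative s x) (at x within {- (R + 1)..R + 1})"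
    using antiderivative_continuous[of "- (R + 1)" "R + 1" s] continuous_on_subset[OF cont] by auto
  have dG: "(G has_real_derivative s x) (at x)" if "\<bar>x\<bar> \<le> R" for x
  proof -
    have "x \<in> interior {- (R + 1)..R + 1}"
      using that by auto
    then have "at x within {- (R + 1)..R + 1} = at x"
      by (rule at_within_interior)
    moreover have "x \<in> {- (R + 1)..R + 1}"
      using that by auto
    ultimately show ?thesis
      using G[of x] by (simp only: has_real_derivative_iff_has_vector_derivative)
  qed
  \<comment> \<open>The odd part of a primitive of an even function is again a primitive.\<close>
  define H where "H x = (G x - G (- x)) / 2" for x
  have dH: "(H has_real_derivative s x) (at x)" if "\<bar>x\<bar> \<le> R" for x
  proof -
    have "((\<lambda>x. G (- x)) has_real_derivative s (- x) * (- 1)) (at x)"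
      by (rule DERIV_chain2[OF dG]) (use that in \<open>auto intro!: derivative_eq_intros\<close>)
    from DERIV_cdivide[OF DERIV_diff[OF dG[OF that] this], of 2] show ?thesis
      by (simp add: H_def[abs_def] even)
  qed
  define k where "k x = H (max (- R) (min R x))" for x
  have cH: "continuous_on {- R..R} H"
    by (intro continuous_at_imp_continuous_on ballI DERIV_isCont[OF dH]) auto
  have "continuous_on UNIV k"
    unfolding k_def by (rule continuous_on_compose2[OF cH]) (use \<open>0 < R\<close> in \<open>auto intro!: continuous_intros\<close>)
  moreover have "k (- x) = - k x" for x
  proof -
    have "max (- R) (min R (- x)) = - max (- R) (min R x)"
      using \<open>0 < R\<close> by (auto simp: max_def min_def)
    then show ?thesis by (simp add: k_def H_def field_simps)
  qed
  moreover have "bounded (H ` {- R..R})"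
    by (intro compact_imp_bounded compact_continuous_image cH) auto
  then obtain C where "\<forall>y\<in>H ` {- R..R}. norm y \<le> C"
    unfolding bounded_iff by blast
  then have "\<bar>k x\<bar> \<le> C" for x
    unfolding k_def using \<open>0 < R\<close> by (auto simp: max_def min_def)
  moreover have "(k has_real_derivative indicator {- R..R} x * s x) (at x)" if "\<bar>x\<bar> \<noteq> R" for x
  proof (cases "\<bar>x\<bar> < R")
    case True
    have "(k has_real_derivative s x) (at x)"
      by (rule has_field_derivative_transform_within_open[OF dH, of x "{- R<..<R}"])
        (use True in \<open>auto simp: k_def max_def min_def\<close>)
    then show ?thesis using True by (auto simp: indicator_def)
  next
    case False
    with that consider "R < x" | "x < - R" by linarith
    then show ?thesis
    proof cases
      case 1
      have "(k has_real_derivative 0) (at x)"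
        by (rule has_field_derivative_transform_within_open[OF DERIV_const, of "{R<..}" x "H R"])
          (use 1 \<open>0 < R\<close> in \<open>auto simp: k_def max_def min_def\<close>)
      then show ?thesis using 1 by (auto simp: indicator_def)
    next
      case 2
      have "(k has_real_derivative 0) (at x)"
        by (rule has_field_derivative_transform_within_open[OF DERIV_const, of "{..<- R}" x "H (- R)"])
          (use 2 \<open>0 < R\<close> in \<open>auto simp: k_def max_def min_def\<close>)
      then show ?thesis using 2 \<open>0 < R\<close> by (auto simp: indicator_def)
    qed
  qed
  ultimately show ?thesis using that by blast
qed

section \<open>Ground states\<close>

lemma ground_state_pos: "ground_state p q \<omega> u \<Longrightarrow> 0 < u x"
  by (simp add: ground_state_def)

lemma ground_state_even: "ground_state p q \<omega> u \<Longrightarrow> u (- x) = u x"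
  by (simp add: ground_state_def)

lemma ground_state_strict_decreasing:
  "ground_state p q \<omega> u \<Longrightarrow> 0 \<le> x \<Longrightarrow> x < y \<Longrightarrow> u y < u x"
  by (simp add: ground_state_def)

lemma ground_state_tendsto_0: "ground_state p q \<omega> u \<Longrightarrow> (u \<longlongrightarrow> 0) at_infinity"
  by (simp add: ground_state_def)

lemma ground_state_abs: "ground_state p q \<omega> u \<Longrightarrow> u \<bar>x\<bar> = u x"
  by (simp add: ground_state_even abs_if)

lemma ground_state_le_0:
  assumes "ground_state p q \<omega> u"
  shows "u x \<le> u 0"
  using ground_state_strict_decreasing[OF assms, of 0 "\<bar>x\<bar>"] ground_state_abs[OF assms, of x]
  by (cases "x = 0") auto

lemma ground_state_less_0:
  assumes "ground_state p q \<omega> u" "x \<noteq> 0"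
  shows "u x < u 0"
  using ground_state_strict_decreasing[OF assms(1), of 0 "\<bar>x\<bar>"] ground_state_abs[OF assms(1), of x] assms
  by auto

lemma ground_state_has_derivative:
  assumes "ground_state p q \<omega> u"
  shows "(u has_real_derivative deriv u x) (at x)"
proof -
  have "u field_differentiable at x"
    using assms unfolding ground_state_def solves_double_power_def differentiable_on_def
    by (simp add: real_differentiable_def field_differentiable_def)
  then show ?thesis
    by (simp add: DERIV_deriv_iff_field_differentiable)
qed

lemma ground_state_has_second_derivative:
  assumes gs: "ground_state p q \<omega> u"
  shows "(deriv u has_real_derivative u x * (\<omega> + u x powr (p - 1) - u x powr (q - 1))) (at x)"
proof -
  have "deriv u field_differentiable at x"
    using assms unfolding ground_state_def solves_double_power_def differentiable_on_def
    by (simp add: real_differentiable_def field_differentiable_def)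
  moreover have "deriv (deriv u) x = u x * (\<omega> + u x powr (p - 1) - u x powr (q - 1))"
    using gs ground_state_pos[OF gs, of x]
    unfolding ground_state_def solves_double_power_def by (auto simp: algebra_simps dest!: spec[of _ x])
  ultimately show ?thesis
    using DERIV_deriv_iff_field_differentiable by metis
qed

lemma ground_state_powr_derivative:
  assumes gs: "ground_state p q \<omega> u"
  shows "((\<lambda>x. u x powr e) has_real_derivative e * u x powr e * deriv u x / u x) (at x)"
  using ground_state_pos[OF gs, of x]
  by (auto intro!: derivative_eq_intros ground_state_has_derivative[OF gs] simp: powr_diff field_simps)

lemma ground_state_continuous:
  assumes "ground_state p q \<omega> u"
  shows "continuous_on A u" "continuous_on A (deriv u)" "continuous_on A (\<lambda>x. u x powr e)"
  using ground_state_has_derivative[OF assms] ground_state_has_second_derivative[OF assms]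
    ground_state_powr_derivative[OF assms, of e]
  by (auto intro!: continuous_at_imp_continuous_on intro: DERIV_isCont)

lemma ground_state_deriv_even:
  assumes gs: "ground_state p q \<omega> u"
  shows "deriv u (- x) = - deriv u x"
proof -
  have "((\<lambda>x. u (- x)) has_real_derivative - deriv u (- x)) (at x)"
    by (rule DERIV_chain2[OF ground_state_has_derivative[OF gs], THEN DERIV_cong])
      (auto intro!: derivative_eq_intros)
  then have "(u has_real_derivative - deriv u (- x)) (at x)"
    by (simp add: ground_state_even[OF gs])
  with ground_state_has_derivative[OF gs] show ?thesis
    using DERIV_unique by fastforce
qed

lemma ground_state_deriv_0:
  assumes gs: "ground_state p q \<omega> u"
  shows "deriv u 0 = 0"
  using ground_state_deriv_even[OF gs, of 0] by simp

lemma ground_state_powr_tendsto_0: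
  assumes gs: "ground_state p q \<omega> u" and "0 < e"
  shows "((\<lambda>x. u x powr e) \<longlongrightarrow> 0) at_infinity"
proof -
  have "((\<lambda>x. u x powr e) \<longlongrightarrow> 0 powr e) at_infinity"
    by (rule tendsto_powr2)
      (use assms ground_state_tendsto_0[OF gs] ground_state_pos[OF gs] in \<open>auto intro!: always_eventually less_imp_le\<close>)
  then show ?thesis by simp
qed

text \<open>Conservation of energy: the equation times \<open>2 u'\<close> is a total derivative,
  and decay at infinity fixes the constant as 0.\<close>

lemma ground_state_first_integral:
  assumes gs: "ground_state p q \<omega> u" and "1 < p" "1 < q"
  shows "(deriv u x)\<^sup>2
    = (u x)\<^sup>2 * (\<omega> + 2 / (p + 1) * u x powr (p - 1) - 2 / (q + 1) * u x powr (q - 1))"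
proof -
  define F where "F x = (u x)\<^sup>2 * (\<omega> + 2 / (p + 1) * u x powr (p - 1) - 2 / (q + 1) * u x powr (q - 1))" for x
  have "((\<lambda>x. (deriv u x)\<^sup>2 - F x) has_real_derivative 0) (at x)" for x
  proof -
    have [simp]: "u x \<noteq> 0" "p + 1 \<noteq> 0" "q + 1 \<noteq> 0"
      using ground_state_pos[OF gs, of x] assms by auto
    let ?P = "u x powr (p - 1)" and ?Q = "u x powr (q - 1)" and ?d = "deriv u x"
    \<comment> \<open>Splits the coefficients that come from differentiating the powers: one part
      matches the nonlinearity, the other cancels against the derivative of the square.\<close>
    have e: "2 / (y + 1) * (y - 1) = 2 - 2 * (2 / (y + 1))" if "y + 1 \<noteq> 0" for y :: real
      using that by (simp add: field_simps)
    have alg: "w\<^sup>2 * (k * (l * m * d / w) - k' * (l' * m' * d / w)) = w * d * ((k * l) * m - (k' * l') * m')"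
      if "w \<noteq> 0" for w k l m d k' l' m' :: real
      using that by (simp add: power2_eq_square algebra_simps)
    define P Q where "P x = u x powr (p - 1)" and "Q x = u x powr (q - 1)" for x
    have [derivative_intros]: "(P has_real_derivative (p - 1) * P x * ?d / u x) (at x)"
      "(Q has_real_derivative (q - 1) * Q x * ?d / u x) (at x)"
      unfolding P_def Q_def by (rule ground_state_powr_derivative[OF gs])+
    have "((\<lambda>x. (deriv u x)\<^sup>2 - F x) has_real_derivative
       2 * ?d * (u x * (\<omega> + ?P - ?Q)) - (2 * u x * ?d * (\<omega> + 2 / (p + 1) * ?P - 2 / (q + 1) * ?Q) +
         (u x)\<^sup>2 * (2 / (p + 1) * ((p - 1) * ?P * ?d / u x) - 2 / (q + 1) * ((q - 1) * ?Q * ?d / u x)))) (at x)"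
      unfolding F_def P_def[symmetric] Q_def[symmetric]
      by (auto intro!: derivative_eq_intros ground_state_has_derivative[OF gs]
        ground_state_has_second_derivative[OF gs, folded P_def Q_def] simp: mult_ac)
    also have "(u x)\<^sup>2 * (2 / (p + 1) * ((p - 1) * ?P * ?d / u x) - 2 / (q + 1) * ((q - 1) * ?Q * ?d / u x))
      = u x * ?d * ((2 / (p + 1) * (p - 1)) * ?P - (2 / (q + 1) * (q - 1)) * ?Q)"
      by (rule alg) simp
    also have "\<dots> = u x * ?d * ((2 - 2 * (2 / (p + 1))) * ?P - (2 - 2 * (2 / (q + 1))) * ?Q)"
      using e[of p] e[of q] by simp
    finally show ?thesis
      by (rule DERIV_cong) (simp add: algebra_simps)
  qed
  then have const: "(deriv u x)\<^sup>2 - F x = (deriv u y)\<^sup>2 - F y" for x y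
    using DERIV_isconst_all[of "\<lambda>x. (deriv u x)\<^sup>2 - F x"] by simp
  \<comment> \<open>By the mean value theorem \<open>u'\<close> tends to 0 along some sequence \<open>\<xi>\<close> that escapes to infinity.\<close>
  have "\<exists>\<xi>>real n. \<xi> < real n + 1 \<and> u (real n + 1) - u (real n) = deriv u \<xi>" for n
    using MVT2[of "real n" "real n + 1" u "deriv u"] ground_state_has_derivative[OF gs] by auto
  then obtain \<xi> where \<xi>: "\<And>n. real n < \<xi> n" "\<And>n. u (real n + 1) - u (real n) = deriv u (\<xi> n)"
    by metis
  have top: "filterlim real at_infinity sequentially" "filterlim (\<lambda>n. real n + 1) at_infinity sequentially"
    "filterlim \<xi> at_infinity sequentially"
  proof -
    show "filterlim real at_infinity sequentially"
      by (simp add: filterlim_at_top_imp_at_infinity filterlim_real_sequentially)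
    show "filterlim (\<lambda>n. real n + 1) at_infinity sequentially"
      by (intro filterlim_at_top_imp_at_infinity filterlim_at_top_mono[OF filterlim_real_sequentially]) auto
    show "filterlim \<xi> at_infinity sequentially"
      by (intro filterlim_at_top_imp_at_infinity filterlim_at_top_mono[OF filterlim_real_sequentially])
        (use \<xi>(1) in \<open>auto intro!: always_eventually less_imp_le\<close>)
  qed
  have "(\<lambda>n. u (real n + 1) - u (real n)) \<longlonglongrightarrow> 0 - 0"
    by (intro tendsto_diff filterlim_compose[OF ground_state_tendsto_0[OF gs]] top)
  then have d: "(\<lambda>n. deriv u (\<xi> n)) \<longlonglongrightarrow> 0"
    by (simp add: \<xi>(2))
  have "(F \<longlongrightarrow> 0\<^sup>2 * (\<omega> + 2 / (p + 1) * 0 - 2 / (q + 1) * 0)) at_infinity"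
    unfolding F_def
    by (intro tendsto_intros ground_state_tendsto_0[OF gs] ground_state_powr_tendsto_0[OF gs])
      (use assms in auto)
  then have "(\<lambda>n. F (\<xi> n)) \<longlonglongrightarrow> 0"
    using filterlim_compose[OF _ top(3)] by fastforce
  then have "(\<lambda>n. (deriv u (\<xi> n))\<^sup>2 - F (\<xi> n)) \<longlonglongrightarrow> 0\<^sup>2 - 0"
    by (intro tendsto_intros d)
  moreover have "(\<lambda>n. (deriv u (\<xi> n))\<^sup>2 - F (\<xi> n)) = (\<lambda>n. (deriv u x)\<^sup>2 - F x)"
    using const by blast
  ultimately have "(deriv u x)\<^sup>2 - F x = 0"
    using tendsto_const_iff[of sequentially "(deriv u x)\<^sup>2 - F x" 0] by (simp add: trivial_limit_sequentially)
  then show ?thesis by (simp add: F_def)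
qed

text \<open>The first integral at the maximum, where \<open>u'\<close> vanishes, ties the frequency
  to the amplitude.\<close>

lemma ground_state_amplitude:
  assumes gs: "ground_state p q \<omega> u" and "1 < p" "1 < q"
  shows "\<omega> = 2 / (q + 1) * u 0 powr (q - 1) - 2 / (p + 1) * u 0 powr (p - 1)"
  using ground_state_first_integral[OF assms, of 0] ground_state_deriv_0[OF gs] ground_state_pos[OF gs, of 0]
  by simp

text \<open>With \<open>t = u x / u 0 < 1\<close> and \<open>\<omega> = B - A\<close> the bracket is
  \<open>B (1 - t^(q-1)) - A (1 - t^(p-1))\<close>. Since \<open>A \<le> B\<close>, it is at least
  \<open>A (t^(p-1) - t^(q-1)) > 0\<close>.\<close>

lemma ground_state_deriv_nonzero:
  assumes gs: "ground_state p q \<omega> u" and pq: "1 < p" "p < q" and "0 \<le> \<omega>" "x \<noteq> 0"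
  shows "0 < \<omega> + 2 / (p + 1) * u x powr (p - 1) - 2 / (q + 1) * u x powr (q - 1)"
    and "deriv u x \<noteq> 0"
proof -
  define t where "t = u x / u 0"
  have t: "0 < t" "t < 1" and ux: "u x = t * u 0"
    using ground_state_less_0[OF gs \<open>x \<noteq> 0\<close>] ground_state_pos[OF gs] by (auto simp: t_def less_imp_neq[THEN not_sym])
  define A B where "A = 2 / (p + 1) * u 0 powr (p - 1)" and "B = 2 / (q + 1) * u 0 powr (q - 1)"
  have \<omega>: "\<omega> = B - A"
    unfolding A_def B_def using ground_state_amplitude[OF gs] pq by simp
  have "0 < A" using ground_state_pos[OF gs, of 0] pq by (auto simp: A_def)
  have "0 < A * (t powr (p - 1) - t powr (q - 1))"
    using \<open>0 < A\<close> t pq powr_less_mono'[of t "p - 1" "q - 1"] by simp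
  also have "\<dots> = A * (1 - t powr (q - 1)) - A * (1 - t powr (p - 1))"
    by (simp add: algebra_simps)
  also have "\<dots> \<le> B * (1 - t powr (q - 1)) - A * (1 - t powr (p - 1))"
    using \<omega> \<open>0 \<le> \<omega>\<close> t pq powr_le1[of "p - 1" t] powr_le1[of "q - 1" t] by (intro diff_mono mult_right_mono) auto
  also have "\<dots> = \<omega> + 2 / (p + 1) * u x powr (p - 1) - 2 / (q + 1) * u x powr (q - 1)"
  proof -
    have "2 / (p + 1) * u x powr (p - 1) = A * t powr (p - 1)"
      "2 / (q + 1) * u x powr (q - 1) = B * t powr (q - 1)"
      unfolding ux using t ground_state_pos[OF gs, of 0] by (simp_all add: powr_mult A_def B_def)
    then show ?thesis by (simp add: \<omega> algebra_simps)
  qed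
  finally show "0 < \<omega> + 2 / (p + 1) * u x powr (p - 1) - 2 / (q + 1) * u x powr (q - 1)" .
  with ground_state_first_integral[OF gs, of x] pq ground_state_pos[OF gs, of x]
  show "deriv u x \<noteq> 0"
    by auto
qed

text \<open>Strict decrease excludes a positive derivative, and
  \<open>ground_state_deriv_nonzero\<close> excludes zero.\<close>

lemma ground_state_deriv_neg:
  assumes gs: "ground_state p q \<omega> u" and pq: "1 < p" "p < q" and "0 \<le> \<omega>" "0 < x"
  shows "deriv u x < 0"
proof (rule ccontr)
  assume "\<not> deriv u x < 0"
  with ground_state_deriv_nonzero(2)[OF assms(1-4), of x] \<open>0 < x\<close> have "0 < deriv u x"
    by auto
  then obtain d where "0 < d" and d: "\<And>h. 0 < h \<Longrightarrow> h < d \<Longrightarrow> u x < u (x + h)"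
    using DERIV_pos_inc_right[OF ground_state_has_derivative[OF gs]] by blast
  have "u x < u (x + d / 2)" using d[of "d / 2"] \<open>0 < d\<close> by simp
  moreover have "u (x + d / 2) < u x"
    using \<open>0 < x\<close> \<open>0 < d\<close> by (intro ground_state_strict_decreasing[OF gs]) auto
  ultimately show False by simp
qed

lemma ground_state_deriv_tendsto_0:
  assumes gs: "ground_state p q \<omega> u" and "1 < p" "1 < q"
  shows "(deriv u \<longlongrightarrow> 0) at_infinity"
proof -
  have "((\<lambda>x. (u x)\<^sup>2 * (\<omega> + 2 / (p + 1) * u x powr (p - 1) - 2 / (q + 1) * u x powr (q - 1)))
      \<longlongrightarrow> 0\<^sup>2 * (\<omega> + 2 / (p + 1) * 0 - 2 / (q + 1) * 0)) at_infinity"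
    by (intro tendsto_intros ground_state_tendsto_0[OF gs] ground_state_powr_tendsto_0[OF gs])
      (use assms in auto)
  then have "((\<lambda>x. (deriv u x)\<^sup>2) \<longlongrightarrow> 0) at_infinity"
    using ground_state_first_integral[OF assms] by simp
  then have "((\<lambda>x. \<bar>deriv u x\<bar>) \<longlongrightarrow> 0) at_infinity"
    using tendsto_real_sqrt by fastforce
  then show ?thesis
    by (rule tendsto_rabs_zero_cancel)
qed

lemma ground_state_level:
  assumes gs: "ground_state p q \<omega> u" and "0 < s" "s \<le> u 0"
  shows "\<exists>x\<ge>0. u x = s"
proof -
  have "\<forall>\<^sub>F x in at_top. u x < s"
    using ground_state_tendsto_0[OF gs, THEN tendsto_mono[OF at_top_le_at_infinity]] \<open>0 < s\<close>
    by (rule order_tendstoD)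
  then obtain X where X: "\<And>x. x \<ge> X \<Longrightarrow> u x < s"
    by (auto simp: eventually_at_top_linorder)
  have "\<exists>x\<ge>0. x \<le> max 0 X \<and> u x = s"
    by (rule IVT2') (use X[of "max 0 X"] assms ground_state_continuous[OF gs] in auto)
  then show ?thesis by blast
qed

section \<open>The inverse of a ground state on the half-line\<close>

context
  fixes p q \<omega> :: real and u :: "real \<Rightarrow> real"
  assumes pq: "1 < p" "p < q" and \<omega>: "0 \<le> \<omega>" and gs: "ground_state p q \<omega> u"
begin

definition level_position :: "real \<Rightarrow> real" where
  "level_position s = inv_into {0..} u s"

lemma level_position_of_value: "0 \<le> x \<Longrightarrow> level_position (u x) = x"
proof -
  have "inj_on u {0..}"
  proof (rule linorder_inj_onI)
    fix x y :: real assume "x < y" "x \<in> {0..}"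
    then show "u x \<noteq> u y"
      using ground_state_strict_decreasing[OF gs, of x y] by simp
  qed auto
  then show "0 \<le> x \<Longrightarrow> level_position (u x) = x"
    unfolding level_position_def by (intro inv_into_f_f) auto
qed

lemma level_position:
  assumes "0 < s" "s \<le> u 0"
  shows "0 \<le> level_position s" and "u (level_position s) = s"
  using ground_state_level[OF gs assms] level_position_of_value by auto

text \<open>A continuous injection on the compact interval \<open>[0, level_position s]\<close> has
  a continuous inverse; \<open>0 < s\<close> keeps that interval bounded.\<close>

lemma level_position_continuous:
  assumes "0 < s"
  shows "continuous_on {s..u 0} level_position"
proof (cases "s \<le> u 0")
  case True
  let ?m = "level_position s"
  have "continuous_on (u ` {0..?m}) level_position"
    by (rule continuous_on_inv) (auto simp: level_position_of_value intro: ground_state_continuous[OF gs])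
  moreover have "{s..u 0} \<subseteq> u ` {0..?m}"
  proof
    fix t assume t: "t \<in> {s..u 0}"
    then have "0 \<le> level_position t" "u (level_position t) = t"
      using level_position[of t] \<open>0 < s\<close> by auto
    moreover have "level_position t \<le> ?m"
    proof (rule ccontr)
      assume "\<not> level_position t \<le> ?m"
      then have "u (level_position t) < u ?m"
        using level_position[OF \<open>0 < s\<close> True] by (intro ground_state_strict_decreasing[OF gs]) auto
      then show False
        using level_position[OF \<open>0 < s\<close> True] level_position[of t] t \<open>0 < s\<close> by simp
    qed
    ultimately show "t \<in> u ` {0..?m}"
      by (metis atLeastAtMost_iff imageI)
  qed
  ultimately show ?thesis by (rule continuous_on_subset)
qed simp

text \<open>The bound \<open>s < u 0\<close> keeps the position away from 0, the only point where
  \<open>u'\<close> vanishes.\<close>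

lemma level_position_deriv:
  assumes "0 < s" "s < u 0"
  shows "(level_position has_real_derivative inverse (deriv u (level_position s))) (at s)"
proof (rule DERIV_inverse_function[where a = 0 and b = "u 0"])
  show "(u has_real_derivative deriv u (level_position s)) (at (level_position s))"
    by (rule ground_state_has_derivative[OF gs])
  have "level_position s \<noteq> 0"
    using level_position(2)[of s] assms by auto
  then show "deriv u (level_position s) \<noteq> 0"
    by (rule ground_state_deriv_nonzero(2)[OF gs pq \<omega>])
  show "u (level_position t) = t" if "0 < t" "t < u 0" for t
    using that level_position(2)[of t] by simp
  have "continuous_on {s / 2<..<u 0} level_position"
    using level_position_continuous[of "s / 2"] assms by (auto intro: continuous_on_subset)
  then show "isCont level_position s"
    using assms by (simp add: continuous_on_eq_continuous_at)
qed (use assms in auto)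

end

section \<open>The zero-frequency profile\<close>

locale double_power_profile =
  fixes p q :: real and f :: "real \<Rightarrow> real"
  assumes p_gt_1: "1 < p" and p_less_q: "p < q" and p_less_5: "p < 5"
    and profile: "ground_state p q 0 f"
begin

lemmas profile_pos = ground_state_pos[OF profile]
  and profile_even = ground_state_even[OF profile]
  and profile_deriv = ground_state_has_derivative[OF profile]
  and profile_deriv2 = ground_state_has_second_derivative[OF profile, simplified]
  and profile_powr_deriv = ground_state_powr_derivative[OF profile]
  and profile_continuous = ground_state_continuous[OF profile]

section \<open>The first integral at frequency zero and the decay of the profile\<close>

definition \<kappa> :: real where "\<kappa> = 2 / (p + 1) * f 0 powr (p - 1)"

text \<open>At zero frequency the two power terms of the first integral balance at the maximum of
  \<open>f\<close>, and \<open>\<kappa>\<close> is their common value.\<close>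

lemma \<kappa>_eq: "\<kappa> = 2 / (q + 1) * f 0 powr (q - 1)"
  using ground_state_amplitude[OF profile] p_gt_1 p_less_q by (simp add: \<kappa>_def)

lemma \<kappa>_pos: "0 < \<kappa>"
  using p_gt_1 profile_pos[of 0] by (simp add: \<kappa>_def)

text \<open>By \<open>deriv_squared\<close> this is \<open>(f' / f)^2\<close>.\<close>

definition D :: "real \<Rightarrow> real" where
  "D x = 2 / (p + 1) * f x powr (p - 1) - 2 / (q + 1) * f x powr (q - 1)"

lemma D_0 [simp]: "D 0 = 0"
  using \<kappa>_eq by (simp add: D_def \<kappa>_def)

lemma D_pos: "x \<noteq> 0 \<Longrightarrow> 0 < D x"
  using ground_state_deriv_nonzero(1)[OF profile p_gt_1 p_less_q order_refl, of x] by (simp add: D_def)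

lemma D_nonneg: "0 \<le> D x"
  using D_pos[of x] by (cases "x = 0") auto

lemma D_even: "D (- x) = D x"
  by (simp add: D_def profile_even)

lemma D_continuous: "continuous_on A D"
  unfolding D_def by (intro continuous_intros profile_continuous)

lemma deriv_squared: "(deriv f x)\<^sup>2 = (f x)\<^sup>2 * D x"
  using ground_state_first_integral[OF profile, of x] p_gt_1 p_less_q by (simp add: D_def)

lemma deriv_eq_sqrt:
  assumes "0 < x"
  shows "deriv f x = - f x * sqrt (D x)"
proof -
  have "sqrt ((deriv f x)\<^sup>2) = sqrt ((f x)\<^sup>2 * D x)"
    by (simp add: deriv_squared)
  with ground_state_deriv_neg[OF profile p_gt_1 p_less_q order_refl \<open>0 < x\<close>] profile_pos[of x]
  show ?thesis by (simp add: real_sqrt_mult)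
qed

lemma D_le: "D x \<le> \<kappa>"
proof -
  have "D x \<le> 2 / (p + 1) * f x powr (p - 1)"
    using p_gt_1 p_less_q by (simp add: D_def)
  also have "\<dots> \<le> \<kappa>"
    unfolding \<kappa>_def using p_gt_1 profile_pos[of x] ground_state_le_0[OF profile, of x]
    by (intro mult_left_mono powr_mono2) auto
  finally show ?thesis .
qed

text \<open>From 1 on, the ratio of \<open>D\<close> to \<open>f^(p-1)\<close> stays above its value
  \<open>m\<close> at 1, so \<open>- f' / f \<ge> sqrt m f^((p-1)/2)\<close>. With
  \<open>e = (5 - p) / 2\<close> the exponents \<open>e\<close> and \<open>(p - 1) / 2\<close> add
  up to 2, so \<open>f\<^sup>2\<close> is dominated by a multiple of \<open>- (f^e)'\<close>, which
  integrates explicitly; \<open>p < 5\<close> makes \<open>e\<close> positive.\<close>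

lemma bounded_integral_profile_squared: "\<exists>B. \<forall>X\<ge>0. integral {0..X} (\<lambda>x. (f x)\<^sup>2) \<le> B"
proof -
  have int: "(\<lambda>x. (f x)\<^sup>2) integrable_on {u..v}" for u v
    by (intro integrable_continuous_real continuous_intros profile_continuous)
  define e m where "e = (5 - p) / 2" and "m = D 1 / f 1 powr (p - 1)"
  define C where "C = e * sqrt m"
  have "0 < m" "0 < C"
    using D_pos[of 1] profile_pos[of 1] p_less_5 by (auto simp: m_def C_def e_def)
  have bound: "(f x)\<^sup>2 \<le> - (e * f x powr e * deriv f x / f x) / C" if "1 \<le> x" for x
  proof -
    have split: "D y = f y powr (p - 1) * (2 / (p + 1) - 2 / (q + 1) * f y powr (q - p))" for y
      by (simp add: D_def algebra_simps flip: powr_add)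
    have "m = 2 / (p + 1) - 2 / (q + 1) * f 1 powr (q - p)"
      using profile_pos[of 1] by (simp add: m_def split[of 1] less_imp_neq[THEN not_sym])
    moreover have "f x \<le> f 1"
      using ground_state_strict_decreasing[OF profile, of 1 x] that by (cases "x = 1") auto
    then have "f x powr (q - p) \<le> f 1 powr (q - p)"
      using profile_pos[of x] p_less_q by (intro powr_mono2) auto
    ultimately have "m \<le> 2 / (p + 1) - 2 / (q + 1) * f x powr (q - p)"
      using p_gt_1 p_less_q by (auto intro!: mult_left_mono divide_right_mono)
    then have "f x powr (p - 1) * m \<le> D x"
      unfolding split[of x] by (intro mult_left_mono) auto
    then have "sqrt (f x powr (p - 1) * m) \<le> sqrt (D x)"
      by (rule real_sqrt_le_mono)
    then have "f x powr ((p - 1) / 2) * sqrt m \<le> sqrt (D x)"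
      using profile_pos[of x] by (simp add: real_sqrt_mult powr_half_sqrt_powr)
    then have "C * f x powr (e + (p - 1) / 2) \<le> e * f x powr e * sqrt (D x)"
      using p_less_5 mult_left_mono[of "f x powr ((p - 1) / 2) * sqrt m" "sqrt (D x)" "e * f x powr e"]
      by (simp add: C_def e_def powr_add mult_ac)
    also have "e + (p - 1) / 2 = 2"
      by (simp add: e_def field_simps)
    also have "e * f x powr e * sqrt (D x) = - (e * f x powr e * deriv f x / f x)"
      using deriv_eq_sqrt[of x] that profile_pos[of x] by simp
    finally have "C * (f x)\<^sup>2 \<le> - (e * f x powr e * deriv f x / f x)"
      using profile_pos[of x] by simp
    then show ?thesis
      using \<open>0 < C\<close> by (subst pos_le_divide_eq) (auto simp: mult.commute)
  qed
  have "integral {0..X} (\<lambda>x. (f x)\<^sup>2) \<le> integral {0..1} (\<lambda>x. (f x)\<^sup>2) + f 1 powr e / C"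
    if "0 \<le> X" for X
  proof -
    \<comment> \<open>Enlarging the interval makes it contain \<open>[0, 1]\<close> whatever the
      size of \<open>X\<close>.\<close>
    have "integral {0..X} (\<lambda>x. (f x)\<^sup>2) \<le> integral {0..1 + X} (\<lambda>x. (f x)\<^sup>2)"
      using that by (intro integral_subset_le int) auto
    also have "\<dots> = integral {0..1} (\<lambda>x. (f x)\<^sup>2) + integral {1..1 + X} (\<lambda>x. (f x)\<^sup>2)"
      using that by (subst Henstock_Kurzweil_Integration.integral_combine) (auto simp: int)
    also have "integral {1..1 + X} (\<lambda>x. (f x)\<^sup>2) \<le> - (f (1 + X) powr e / C) - - (f 1 powr e / C)"
    proof (rule has_integral_le)
      show "((\<lambda>x. (f x)\<^sup>2) has_integral integral {1..1 + X} (\<lambda>x. (f x)\<^sup>2)) {1..1 + X}"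
        using int by (simp add: has_integral_integral)
      have dC: "((\<lambda>x. - (f x powr e / C)) has_real_derivative - (e * f x powr e * deriv f x / f x) / C) (at x)" for x
        by (rule DERIV_cong[OF DERIV_minus[OF DERIV_cdivide[OF profile_powr_deriv]]]) simp
      show "((\<lambda>x. - (e * f x powr e * deriv f x / f x) / C) has_integral
          - (f (1 + X) powr e / C) - - (f 1 powr e / C)) {1..1 + X}"
        using that by (intro has_integral_FTC_finite_exceptions[of "{}"] dC
            continuous_at_imp_continuous_on ballI DERIV_isCont[OF dC]) auto
    qed (use bound in auto)
    also have "- (f (1 + X) powr e / C) - - (f 1 powr e / C) \<le> f 1 powr e / C"
      using \<open>0 < C\<close> by simp
    finally show ?thesis by simp
  qed
  then show ?thesis by blast
qed

lemma profile_squared_integrable: "integrable lborel (\<lambda>x. (f x)\<^sup>2)"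
  using bounded_integral_profile_squared profile_even
  by (auto intro!: integrable_even_of_bounded_integrals continuous_intros profile_continuous)

lemma profile_L2: "f \<in> L2"
  using profile_squared_integrable borel_measurable_continuous_onI[OF profile_continuous(1)]
  by (simp add: L2_def)

lemma profile_deriv_L2: "deriv f \<in> L2"
proof -
  have "integrable lborel (\<lambda>x. (deriv f x)\<^sup>2)"
  proof (rule Bochner_Integration.integrable_bound)
    show "integrable lborel (\<lambda>x. \<kappa> * (f x)\<^sup>2)"
      using profile_squared_integrable by simp
    show "(\<lambda>x. (deriv f x)\<^sup>2) \<in> borel_measurable lborel"
      using borel_measurable_continuous_onI[OF profile_continuous(2)] by auto
    show "AE x in lborel. norm ((deriv f x)\<^sup>2) \<le> norm (\<kappa> * (f x)\<^sup>2)"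
      using \<kappa>_pos D_nonneg by (intro AE_I2) (auto simp: deriv_squared abs_mult mult.commute[of \<kappa>] intro!: mult_left_mono D_le)
  qed
  then show ?thesis
    using borel_measurable_continuous_onI[OF profile_continuous(2)] by (simp add: L2_def)
qed

text \<open>The weight records how a change of amplitude acts on the first integral: where another
  ground state \<open>u\<close> has the value \<open>\<theta> f y\<close>, its
  \<open>(u' / u)^2\<close> is \<open>D y\<close> times an affine function of
  \<open>\<rho> y\<close>, namely \<open>z\<close> (see \<open>X_deriv\<close>). The value at 0 is
  the limit of the quotient.\<close>

definition \<rho> :: "real \<Rightarrow> real" where
  "\<rho> x = (if x = 0 then (q - 1) / (q - p) else (\<kappa> - 2 / (q + 1) * f x powr (q - 1)) / D x)"

lemma \<rho>_even: "\<rho> (- x) = \<rho> x"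
  by (simp add: \<rho>_def profile_even D_even)

lemma \<rho>_pos: "0 < \<rho> x"
proof (cases "x = 0")
  case False
  have "f x powr (q - 1) < f 0 powr (q - 1)"
    using ground_state_less_0[OF profile False] profile_pos[of x] p_gt_1 p_less_q
    by (intro powr_less_mono2) auto
  then show ?thesis
    using D_pos[OF False] False p_gt_1 p_less_q by (simp add: \<rho>_def \<kappa>_eq divide_strict_right_mono)
qed (use p_gt_1 p_less_q in \<open>simp add: \<rho>_def\<close>)

lemma \<rho>_continuous: "continuous_on A \<rho>"
proof -
  have "isCont \<rho> x" for x
  proof (cases "x = 0")
    case False
    have "continuous_on (- {0}) (\<lambda>x. (\<kappa> - 2 / (q + 1) * f x powr (q - 1)) / D x)"
      using D_pos by (intro continuous_intros profile_continuous D_continuous) (auto simp: less_imp_neq[THEN not_sym])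
    then have "continuous_on (- {0}) \<rho>"
      by (rule continuous_on_cong[THEN iffD1, rotated 2]) (auto simp: \<rho>_def)
    then show ?thesis
      using False by (simp add: continuous_on_eq_continuous_at open_Compl)
  next
    case True
    \<comment> \<open>As functions of the level \<open>s = f x\<close> both vanish exactly to first
      order at \<open>f 0\<close>, so the quotient tends to the ratio of their derivatives. In the
      variable \<open>x\<close> both would be stationary at 0.\<close>
    define n d where "n s = \<kappa> - 2 / (q + 1) * s powr (q - 1)"
      and "d s = 2 / (p + 1) * s powr (p - 1) - 2 / (q + 1) * s powr (q - 1)" for s :: real
    let ?n' = "- (2 / (q + 1) * ((q - 1) * f 0 powr (q - 1 - 1)))"
    let ?d' = "2 / (p + 1) * ((p - 1) * f 0 powr (p - 1 - 1)) - 2 / (q + 1) * ((q - 1) * f 0 powr (q - 1 - 1))"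
    have a: "0 < f 0" by (rule profile_pos)
    have eq: "?n' = - ((q - 1) * \<kappa> / f 0)" "?d' = - ((q - p) * \<kappa> / f 0)"
    proof -
      show n: "?n' = - ((q - 1) * \<kappa> / f 0)"
        using a by (simp add: \<kappa>_eq powr_diff power2_eq_square mult_ac)
      have "2 / (p + 1) * ((p - 1) * f 0 powr (p - 1 - 1)) = (p - 1) * \<kappa> / f 0"
        using a by (simp add: \<kappa>_def powr_diff power2_eq_square mult_ac)
      with n have "?d' = (p - 1) * \<kappa> / f 0 - (q - 1) * \<kappa> / f 0"
        by simp
      also have "\<dots> = - ((q - p) * \<kappa> / f 0)"
        using a by (simp add: field_simps)
      finally show "?d' = - ((q - p) * \<kappa> / f 0)" .
    qed
    have nd: "(n has_real_derivative ?n') (at (f 0))" "(d has_real_derivative ?d') (at (f 0))"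
      unfolding n_def d_def using a p_gt_1 p_less_q by (auto intro!: derivative_eq_intros simp: mult_ac)
    have 0: "n (f 0) = 0" "d (f 0) = 0"
      using D_0 \<kappa>_eq by (simp_all add: n_def d_def D_def)
    have "?d' \<noteq> 0"
      unfolding eq(2) using a \<kappa>_pos p_less_q by simp
    then have "((\<lambda>s. ((n s - n (f 0)) / (s - f 0)) / ((d s - d (f 0)) / (s - f 0))) \<longlongrightarrow> ?n' / ?d') (at (f 0))"
      using nd unfolding has_field_derivative_iff by (rule tendsto_divide[rotated 2])
    \<comment> \<open>Off the origin \<open>f\<close> avoids the value \<open>f 0\<close>, so the
      limit in \<open>s\<close> can be pulled back to \<open>x\<close>.\<close>
    moreover have "filterlim f (at (f 0)) (at 0)"
      unfolding filterlim_at
      using DERIV_isCont[OF profile_deriv, of 0] ground_state_less_0[OF profile, THEN less_imp_neq]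
      by (auto simp: isCont_def eventually_at_filter intro!: always_eventually)
    ultimately have "((\<lambda>x. ((n (f x) - n (f 0)) / (f x - f 0)) / ((d (f x) - d (f 0)) / (f x - f 0)))
        \<longlongrightarrow> ?n' / ?d') (at 0)"
      by (rule filterlim_compose)
    moreover have "((n (f x) - n (f 0)) / (f x - f 0)) / ((d (f x) - d (f 0)) / (f x - f 0)) = \<rho> x"
      if "x \<noteq> 0" for x
      using that ground_state_less_0[OF profile that] by (simp add: 0) (simp add: n_def d_def \<rho>_def D_def)
    then have "\<forall>\<^sub>F x in at 0. ((n (f x) - n (f 0)) / (f x - f 0)) / ((d (f x) - d (f 0)) / (f x - f 0)) = \<rho> x"
      by (auto simp: eventually_at_filter intro!: always_eventually)
    ultimately have "(\<rho> \<longlongrightarrow> ?n' / ?d') (at 0)"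
      by (rule Lim_transform_eventually)
    also have "?n' / ?d' = \<rho> 0"
      unfolding eq using a \<kappa>_pos p_less_q by (simp add: \<rho>_def)
    finally show ?thesis
      by (simp add: True isCont_def)
  qed
  then show ?thesis by (simp add: continuous_at_imp_continuous_on)
qed

text \<open>\<open>\<gamma>\<close> and \<open>c\<^sub>0\<close> are determined by the two equations
  \<open>coeff\<close> in the proof of \<open>\<rho>_identity\<close>: they make
  \<open>D (\<rho> + \<gamma> + c\<^sub>0)\<close> collapse to
  \<open>\<kappa> + c\<^sub>0 (f^(p-1) - f^(q-1))\<close>.\<close>

definition \<gamma> :: real where "\<gamma> = (p - 1) / (q - p)"

definition c\<^sub>0 :: real where "c\<^sub>0 = 2 / (q - p)"

lemma c\<^sub>0_pos: "0 < c\<^sub>0"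
  using p_less_q by (simp add: c\<^sub>0_def)

lemma \<gamma>_pos: "0 < \<gamma>"
  using p_gt_1 p_less_q by (simp add: \<gamma>_def)

section \<open>The linearised equation along the profile\<close>

definition g :: "real \<Rightarrow> real" where
  "g x = f x * (f x powr (p - 1) - f x powr (q - 1))"

definition V :: "real \<Rightarrow> real" where
  "V x = p * f x powr (p - 1) - q * f x powr (q - 1)"

lemma profile_deriv2_g: "(deriv f has_real_derivative g x) (at x)"
  using profile_deriv2 by (simp add: g_def)

text \<open>Since \<open>g\<close> is \<open>f''\<close>, this is \<open>f''' = V f'\<close>, that
  is, \<open>L\<^sub>0 f' = 0\<close>.\<close>

lemma g_deriv: "(g has_real_derivative V x * deriv f x) (at x)"
proof -
  have "(g has_real_derivative deriv f x * (f x powr (p - 1) - f x powr (q - 1)) +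
      ((p - 1) * f x powr (p - 1) * deriv f x / f x - (q - 1) * f x powr (q - 1) * deriv f x / f x) * f x) (at x)"
    unfolding g_def by (intro DERIV_mult DERIV_diff profile_deriv profile_powr_deriv)
  then show ?thesis
    by (rule DERIV_cong) (use profile_pos[of x] in \<open>simp add: V_def field_simps\<close>)
qed

lemma g_continuous: "continuous_on A g" and V_continuous: "continuous_on A V"
  unfolding g_def V_def by (intro continuous_intros profile_continuous)+

lemma powr_profile_bounded: "0 < e \<Longrightarrow> \<bar>f x powr e\<bar> \<le> f 0 powr e"
  using profile_pos[of x] ground_state_le_0[OF profile, of x] by (auto intro: powr_mono2)

lemma V_bounded: "\<bar>V x\<bar> \<le> p * f 0 powr (p - 1) + q * f 0 powr (q - 1)"
proof -
  have "\<bar>V x\<bar> \<le> \<bar>p * f x powr (p - 1)\<bar> + \<bar>q * f x powr (q - 1)\<bar>"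
    unfolding V_def by (rule abs_triangle_ineq4)
  also have "\<dots> \<le> p * f 0 powr (p - 1) + q * f 0 powr (q - 1)"
    using powr_profile_bounded[of "p - 1" x] powr_profile_bounded[of "q - 1" x] p_gt_1 p_less_q
    by (intro add_mono) (auto simp: abs_mult intro!: mult_left_mono)
  finally show ?thesis .
qed

lemma g_L2: "g \<in> L2"
proof -
  have "(\<lambda>x. (f x powr (p - 1) - f x powr (q - 1)) * f x) \<in> L2"
  proof (rule L2_continuous_bounded_mult[OF profile_L2])
    show "\<bar>f x powr (p - 1) - f x powr (q - 1)\<bar> \<le> f 0 powr (p - 1) + f 0 powr (q - 1)" for x
      using powr_profile_bounded[of "p - 1" x] powr_profile_bounded[of "q - 1" x] p_gt_1 p_less_q
      by (intro order_trans[OF abs_triangle_ineq4 add_mono]) auto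
  qed (intro continuous_intros profile_continuous)
  then show ?thesis by (simp add: g_def[abs_def] mult.commute)
qed

lemma profile_tendsto_0: "(f \<longlongrightarrow> 0) at_infinity" "(deriv f \<longlongrightarrow> 0) at_infinity" "(g \<longlongrightarrow> 0) at_infinity"
proof -
  show "(f \<longlongrightarrow> 0) at_infinity" "(deriv f \<longlongrightarrow> 0) at_infinity"
    using ground_state_tendsto_0[OF profile] ground_state_deriv_tendsto_0[OF profile] p_gt_1 p_less_q by auto
  have "(g \<longlongrightarrow> 0 * (0 - 0)) at_infinity"
    unfolding g_def
    by (intro tendsto_intros ground_state_tendsto_0[OF profile] ground_state_powr_tendsto_0[OF profile])
      (use p_gt_1 p_less_q in auto)
  then show "(g \<longlongrightarrow> 0) at_infinity" by simp
qed

text \<open>On \<open>(0, \<infinity>)\<close> the function \<open>v = c\<^sub>0 f + f' \<integral> (\<rho> + \<gamma>)\<close> solves \<open>L\<^sub>0 v = - 2 \<kappa> f\<close>;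
  this identity is the equation after one integration.\<close>

lemma \<rho>_identity:
  "(deriv f x)\<^sup>2 * (\<rho> x + \<gamma> + c\<^sub>0) = \<kappa> * (f x)\<^sup>2 + c\<^sub>0 * f x * g x"
proof -
  let ?P = "f x powr (p - 1)" and ?Q = "f x powr (q - 1)"
  have nz: "p + 1 \<noteq> 0" "q + 1 \<noteq> 0" "q - p \<noteq> 0" using p_gt_1 p_less_q by auto
  have coeff: "(\<gamma> + c\<^sub>0) * (2 / (p + 1)) = c\<^sub>0" "2 / (q + 1) + (\<gamma> + c\<^sub>0) * (2 / (q + 1)) = c\<^sub>0"
    using nz by (auto simp: \<gamma>_def c\<^sub>0_def divide_simps)
  \<comment> \<open>At 0 both \<open>D\<close> and the numerator of \<open>\<rho>\<close> vanish, by
    \<open>\<kappa>_eq\<close>.\<close>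
  have "D x * (\<rho> x + \<gamma> + c\<^sub>0) = \<kappa> - 2 / (q + 1) * ?Q + (\<gamma> + c\<^sub>0) * D x"
    using D_pos[of x] \<kappa>_eq by (cases "x = 0") (auto simp: \<rho>_def field_simps)
  also have "\<dots> = \<kappa> + ((\<gamma> + c\<^sub>0) * (2 / (p + 1))) * ?P - (2 / (q + 1) + (\<gamma> + c\<^sub>0) * (2 / (q + 1))) * ?Q"
    by (simp add: D_def algebra_simps)
  also have "\<dots> = \<kappa> + c\<^sub>0 * (?P - ?Q)"
    unfolding coeff by (simp add: algebra_simps)
  finally have D: "D x * (\<rho> x + \<gamma> + c\<^sub>0) = \<kappa> + c\<^sub>0 * (?P - ?Q)" .
  have "(deriv f x)\<^sup>2 * (\<rho> x + \<gamma> + c\<^sub>0) = (f x)\<^sup>2 * (D x * (\<rho> x + \<gamma> + c\<^sub>0))"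
    by (simp add: deriv_squared)
  also have "\<dots> = \<kappa> * (f x)\<^sup>2 + c\<^sub>0 * f x * g x"
    unfolding D by (simp add: g_def power2_eq_square algebra_simps)
  finally show ?thesis .
qed

text \<open>The boundary term left when \<open>L\<^sub>0 v = - 2 \<kappa> f\<close> is tested
  against \<open>f\<close> on an interval, after the contributions with the primitive of
  \<open>\<rho> + \<gamma>\<close> have cancelled.\<close>

definition Z :: "real \<Rightarrow> real" where
  "Z x = f x * deriv f x * (\<rho> x + \<gamma> + c\<^sub>0)"

lemma Z_continuous: "continuous_on A Z"
  unfolding Z_def by (intro continuous_intros profile_continuous \<rho>_continuous)

text \<open>By \<open>\<rho>_identity\<close>, \<open>Z\<close> equals \<open>h / f'\<close> with
  \<open>h\<close> free of \<open>\<rho>\<close>, so \<open>\<rho>\<close> itself is never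
  differentiated. The point 0 is excluded because \<open>f'\<close> vanishes there.\<close>

lemma Z_deriv:
  assumes "x \<noteq> 0"
  shows "(Z has_real_derivative ((deriv f x)\<^sup>2 - f x * g x) * (\<rho> x + \<gamma>)
    + 2 * \<kappa> * (f x)\<^sup>2 + c\<^sub>0 * ((deriv f x)\<^sup>2 + V x * (f x)\<^sup>2)) (at x)"
proof -
  have nz: "deriv f y \<noteq> 0" if "y \<noteq> 0" for y
    using that ground_state_deriv_nonzero(2)[OF profile p_gt_1 p_less_q order_refl] by blast
  define h where "h y = (f y)\<^sup>2 * (\<kappa> * f y + c\<^sub>0 * g y)" for y
  have h: "h y = f y * ((deriv f y)\<^sup>2 * (\<rho> y + \<gamma> + c\<^sub>0))" for y
    unfolding \<rho>_identity by (simp add: h_def power2_eq_square algebra_simps)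
  have "(h has_real_derivative 2 * f x * deriv f x * (\<kappa> * f x + c\<^sub>0 * g x) +
      (f x)\<^sup>2 * (\<kappa> * deriv f x + c\<^sub>0 * (V x * deriv f x))) (at x)"
    unfolding h_def by (auto intro!: derivative_eq_intros profile_deriv g_deriv)
  then have "((\<lambda>x. h x / deriv f x) has_real_derivative
     ((2 * f x * deriv f x * (\<kappa> * f x + c\<^sub>0 * g x) +
      (f x)\<^sup>2 * (\<kappa> * deriv f x + c\<^sub>0 * (V x * deriv f x))) * deriv f x - h x * g x)
      / (deriv f x * deriv f x)) (at x)"
    using nz[OF assms] by (intro DERIV_divide profile_deriv2_g)
  \<comment> \<open>At 0 the quotient is 0 by the convention for division by zero, and
    \<open>Z\<close> is 0 because \<open>f'\<close> vanishes.\<close>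
  also have "(\<lambda>x. h x / deriv f x) = Z"
  proof
    fix y show "h y / deriv f y = Z y"
      using nz[of y] ground_state_deriv_0[OF profile]
      by (cases "y = 0") (auto simp: h Z_def power2_eq_square)
  qed
  finally show ?thesis
  proof (rule DERIV_cong)
    define d s where "d = deriv f x" and "s = \<rho> x + \<gamma>"
    have "d \<noteq> 0" using nz[OF assms] by (simp add: d_def)
    have eq: "d\<^sup>2 * s = \<kappa> * (f x)\<^sup>2 + c\<^sub>0 * f x * g x - c\<^sub>0 * d\<^sup>2"
      using \<rho>_identity[of x] by (simp add: d_def s_def algebra_simps)
    have hx: "h x = f x * (d\<^sup>2 * (s + c\<^sub>0))"
      by (simp add: h d_def s_def)
    have "((2 * f x * d * (\<kappa> * f x + c\<^sub>0 * g x) + (f x)\<^sup>2 * (\<kappa> * d + c\<^sub>0 * (V x * d))) * d - h x * g x) / (d * d)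
      = 2 * f x * (\<kappa> * f x + c\<^sub>0 * g x) + (f x)\<^sup>2 * (\<kappa> + c\<^sub>0 * V x) - f x * (s + c\<^sub>0) * g x"
      unfolding hx using \<open>d \<noteq> 0\<close> by (subst nonzero_divide_eq_eq) (auto simp: power2_eq_square algebra_simps)
    also have "\<dots> = (\<kappa> * (f x)\<^sup>2 + c\<^sub>0 * f x * g x - c\<^sub>0 * d\<^sup>2) - f x * g x * s
        + 2 * \<kappa> * (f x)\<^sup>2 + c\<^sub>0 * (d\<^sup>2 + V x * (f x)\<^sup>2)"
      by (simp add: power2_eq_square algebra_simps)
    also have "\<dots> = (d\<^sup>2 - f x * g x) * s + 2 * \<kappa> * (f x)\<^sup>2 + c\<^sub>0 * (d\<^sup>2 + V x * (f x)\<^sup>2)"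
      unfolding eq[symmetric] by (simp add: algebra_simps)
    finally show "((2 * f x * deriv f x * (\<kappa> * f x + c\<^sub>0 * g x) +
        (f x)\<^sup>2 * (\<kappa> * deriv f x + c\<^sub>0 * (V x * deriv f x))) * deriv f x - h x * g x) / (deriv f x * deriv f x)
      = ((deriv f x)\<^sup>2 - f x * g x) * (\<rho> x + \<gamma>) + 2 * \<kappa> * (f x)\<^sup>2
        + c\<^sub>0 * ((deriv f x)\<^sup>2 + V x * (f x)\<^sup>2)"
      by (simp add: d_def s_def)
  qed
qed

lemma Z_odd_nonpos:
  assumes "0 \<le> R"
  shows "Z R - Z (- R) \<le> 0"
proof -
  have "Z (- R) = - Z R"
    by (simp add: Z_def profile_even ground_state_deriv_even[OF profile] \<rho>_even)
  moreover have "Z R \<le> 0"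
  proof (cases "R = 0")
    case False
    with assms have "deriv f R < 0"
      by (intro ground_state_deriv_neg[OF profile p_gt_1 p_less_q]) auto
    then show ?thesis
      unfolding Z_def using profile_pos[of R] \<rho>_pos[of R] \<gamma>_pos c\<^sub>0_pos
      by (intro mult_nonpos_nonneg mult_nonneg_nonpos) auto
  qed (simp add: Z_def ground_state_deriv_0[OF profile])
  ultimately show ?thesis by simp
qed

text \<open>The integrand of the form of \<open>L\<^sub>0\<close> at \<open>f\<close>
  itself.\<close>

definition w :: "real \<Rightarrow> real" where
  "w x = (deriv f x)\<^sup>2 + V x * (f x)\<^sup>2"

lemma w_continuous: "continuous_on A w"
  unfolding w_def by (intro continuous_intros profile_continuous V_continuous)

lemma V_mult_L2: "u \<in> L2 \<Longrightarrow> (\<lambda>x. V x * u x) \<in> L2"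
  by (rule L2_continuous_bounded_mult[OF _ V_continuous V_bounded])

lemma w_integrable: "integrable lborel w"
  using L2_mult_integrable[OF profile_deriv_L2 profile_deriv_L2]
    L2_mult_integrable[OF V_mult_L2[OF profile_L2] profile_L2]
  by (simp add: w_def[abs_def] power2_eq_square mult.assoc)

text \<open>Testing the equation with \<open>f\<close> shows that \<open>f'\<^sup>2 + f f''\<close>
  has integral zero, and \<open>p\<close> times this function dominates \<open>w\<close>
  pointwise.\<close>

lemma w_integral_nonpos: "(LINT x|lborel. w x) \<le> 0"
proof -
  have int: "integrable lborel (\<lambda>x. deriv f x * deriv f x + g x * f x)"
    using L2_mult_integrable profile_deriv_L2 profile_L2 g_L2 by (intro Bochner_Integration.integrable_add) auto
  have "((\<lambda>x. f x * deriv f x) \<longlongrightarrow> 0 * 0) at_infinity"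
    by (intro tendsto_mult profile_tendsto_0)
  then have "(LINT x|lborel. deriv f x * deriv f x + g x * f x) = 0"
    by (intro lebesgue_integral_derivative_vanishing_at_infinity[of "{}" "\<lambda>x. f x * deriv f x"])
      (auto intro!: continuous_intros profile_continuous DERIV_mult profile_deriv profile_deriv2_g int)
  moreover have "w x \<le> p * (deriv f x * deriv f x + g x * f x)" for x
  proof -
    have "p * (deriv f x * deriv f x + g x * f x) - w x
      = (p - 1) * (deriv f x)\<^sup>2 + (q - p) * (f x)\<^sup>2 * f x powr (q - 1)"
      by (simp add: w_def g_def V_def power2_eq_square algebra_simps)
    also have "\<dots> \<ge> 0"
      using p_gt_1 p_less_q by simp
    finally show ?thesis by simp
  qed
  then have "(LINT x|lborel. w x) \<le> (LINT x|lborel. p * (deriv f x * deriv f x + g x * f x))"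
    by (intro integral_mono w_integrable integrable_mult_right int)
  ultimately show ?thesis by simp
qed

subsection \<open>Trial functions\<close>

text \<open>The function is \<open>c f + k f'\<close> with \<open>k\<close> odd,
  \<open>k' = \<rho> + \<gamma>\<close> on \<open>[- R, R]\<close> and \<open>k\<close> constant
  beyond. Because \<open>L\<^sub>0 f' = 0\<close>, the terms with undifferentiated \<open>k\<close>
  are absorbed by a total derivative. Besides \<open>c\<^sup>2 w\<close> there remains an integral
  over \<open>[- R, R]\<close>, evaluated by \<open>\<rho>_identity\<close> and
  \<open>Z_deriv\<close>.\<close>

lemma trial_function:
  fixes R c :: real
  assumes "0 < R"
  defines "A \<equiv> integral {- R..R} (\<lambda>x. (f x)\<^sup>2 * (\<rho> x + \<gamma>))"
  obtains \<psi> \<psi>' where "\<psi> \<in> H1_rad" "has_L2_weak_derivative \<psi> \<psi>'"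
    "L2_inner \<psi> f = c * (LINT x|lborel. (f x)\<^sup>2) - A / 2"
    "L0_form p q f \<psi> \<psi>' = c\<^sup>2 * (LINT x|lborel. w x) + \<kappa> * A
      + (2 * c - c\<^sub>0) * (Z R - Z (- R) - 2 * \<kappa> * integral {- R..R} (\<lambda>x. (f x)\<^sup>2) - c\<^sub>0 * integral {- R..R} w)"
proof -
  define s where "s x = \<rho> x + \<gamma>" for x
  have cs: "continuous_on B s" for B
    unfolding s_def by (intro continuous_intros \<rho>_continuous)
  obtain k C where ck: "continuous_on UNIV k" and k_odd: "\<And>x. k (- x) = - k x"
    and kC: "\<And>x. \<bar>k x\<bar> \<le> C"
    and dk: "\<And>x. \<bar>x\<bar> \<noteq> R \<Longrightarrow> (k has_real_derivative indicator {- R..R} x * s x) (at x)"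
    using odd_primitive[of s R] cs \<rho>_even \<open>0 < R\<close> by (auto simp: s_def)
  define S :: "real \<Rightarrow> real" where "S x = indicator {- R..R} x * s x" for x
  define \<psi> \<psi>' where "\<psi> x = c * f x + k x * deriv f x"
    and "\<psi>' x = c * deriv f x + (k x * g x + S x * deriv f x)" for x
  have fin: "finite {- R, R}" by simp
  have off: "\<bar>x\<bar> \<noteq> R" if "x \<notin> {- R, R}" for x using that by auto
  have S_bounded: "\<exists>B. \<forall>x. \<bar>S x\<bar> \<le> B"
  proof -
    have "bounded (s ` {- R..R})"
      by (intro compact_imp_bounded compact_continuous_image cs) auto
    then obtain B where "\<forall>y\<in>s ` {- R..R}. norm y \<le> B"
      unfolding bounded_iff by blast
    then have "\<bar>S x\<bar> \<le> max 0 B" for x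
      by (cases "x \<in> {- R..R}") (auto simp: S_def le_max_iff_disj)
    then show ?thesis by blast
  qed
  have mS: "S \<in> borel_measurable borel"
    unfolding S_def using borel_measurable_continuous_onI[OF cs] by simp
  have cf_L2: "(\<lambda>x. c * f x) \<in> L2" "(\<lambda>x. c * deriv f x) \<in> L2"
    by (intro L2_bounded_mult[where C = "\<bar>c\<bar>"] profile_L2 profile_deriv_L2; simp)+
  have \<psi>_L2: "\<psi> \<in> L2"
    unfolding \<psi>_def
    by (intro L2_add cf_L2 L2_continuous_bounded_mult[OF profile_deriv_L2 ck kC])
  have \<psi>'_L2: "\<psi>' \<in> L2"
  proof -
    obtain B where "\<And>x. \<bar>S x\<bar> \<le> B" using S_bounded by blast
    then show ?thesis
      unfolding \<psi>'_def
      by (intro L2_add cf_L2 L2_continuous_bounded_mult[OF g_L2 ck kC] L2_bounded_mult[OF profile_deriv_L2 mS])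
  qed
  have d\<psi>: "(\<psi> has_real_derivative \<psi>' x) (at x)" if "x \<notin> {- R, R}" for x
    unfolding \<psi>_def \<psi>'_def S_def
    by (rule DERIV_cong[OF DERIV_add[OF DERIV_cmult[OF profile_deriv]
        DERIV_mult[OF dk[OF off[OF that]] profile_deriv2_g]]]) simp
  have c\<psi>: "continuous_on UNIV \<psi>"
    unfolding \<psi>_def by (intro continuous_intros ck profile_continuous)
  have weak: "has_L2_weak_derivative \<psi> \<psi>'"
    by (rule has_L2_weak_derivativeI[OF fin c\<psi> d\<psi> \<psi>_L2 \<psi>'_L2])
  have "\<psi> (- x) = \<psi> x" for x
    by (simp add: \<psi>_def k_odd profile_even ground_state_deriv_even[OF profile])
  with weak \<psi>_L2 have H1: "\<psi> \<in> H1_rad"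
    by (auto simp: H1_rad_def H1_def)
  have k_lim: "((\<lambda>x. k x * u x) \<longlongrightarrow> 0) at_infinity" if "(u \<longlongrightarrow> 0) at_infinity" for u :: "real \<Rightarrow> real"
    by (rule lim_null_mult_left_bounded[OF _ that, of _ C]) (simp add: kC)
  define N where "N = (LINT x|lborel. (f x)\<^sup>2)"
  have iff: "integrable lborel (\<lambda>x. (f x)\<^sup>2)" by (rule profile_squared_integrable)
  note compact = lebesgue_integral_interval_continuous[of "- R" R]

  have "L2_inner \<psi> f = c * N - A / 2"
  proof -
    define B where "B x = indicator {- R..R} x * ((f x)\<^sup>2 * s x)" for x
    have B: "integrable lborel B" "(LINT x|lborel. B x) = A"
      unfolding B_def A_def s_def[symmetric]
      by (intro compact continuous_intros profile_continuous cs)+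
    \<comment> \<open>Since \<open>f f'\<close> is half the derivative of \<open>f\<^sup>2\<close>,
      integration by parts moves the derivative onto \<open>k\<close>.\<close>
    define T where "T x = (f x)\<^sup>2 * k x / 2" for x
    have int_k: "integrable lborel (\<lambda>x. k x * deriv f x * f x)"
      by (intro L2_mult_integrable L2_continuous_bounded_mult[OF profile_deriv_L2 ck kC] profile_L2)
    have "(LINT x|lborel. k x * deriv f x * f x + B x / 2) = 0"
    proof (rule lebesgue_integral_derivative_vanishing_at_infinity[OF fin, of T])
      show "continuous_on UNIV T"
        unfolding T_def by (intro continuous_intros ck profile_continuous) auto
      show "(T has_real_derivative k x * deriv f x * f x + B x / 2) (at x)" if "x \<notin> {- R, R}" for x
        unfolding T_def B_def
        by (rule DERIV_cong[OF DERIV_cdivide[OF DERIV_mult[OF DERIV_power[OF profile_deriv] dk[OF off[OF that]]]]])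
          (simp add: algebra_simps)
      show "integrable lborel (\<lambda>x. k x * deriv f x * f x + B x / 2)"
        using int_k B by (intro Bochner_Integration.integrable_add) auto
      have "((\<lambda>x. k x * (f x)\<^sup>2) \<longlongrightarrow> 0) at_infinity"
        by (rule k_lim) (use tendsto_power[OF profile_tendsto_0(1), of 2] in simp)
      then show "(T \<longlongrightarrow> 0) at_infinity"
        unfolding T_def using tendsto_divide[of _ 0 _ "\<lambda>_. 2" 2] by (fastforce simp: mult.commute)
    qed
    then have eq: "(LINT x|lborel. k x * deriv f x * f x) = - A / 2"
      using int_k B by simp
    have "L2_inner \<psi> f = (LINT x|lborel. c * (f x)\<^sup>2 + k x * deriv f x * f x)"
      by (simp add: L2_inner_def \<psi>_def power2_eq_square distrib_right mult.assoc)
    also have "\<dots> = c * N - A / 2"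
      using iff int_k by (simp add: eq N_def)
    finally show ?thesis .
  qed
  moreover have "L0_form p q f \<psi> \<psi>' = c\<^sup>2 * (LINT x|lborel. w x) + \<kappa> * A
      + (2 * c - c\<^sub>0) * (Z R - Z (- R) - 2 * \<kappa> * integral {- R..R} (\<lambda>x. (f x)\<^sup>2) - c\<^sub>0 * integral {- R..R} w)"
  proof -
    define F where "F x = (\<psi>' x)\<^sup>2 + V x * (\<psi> x)\<^sup>2" for x
    have F_int: "integrable lborel F"
      using L2_mult_integrable[OF \<psi>'_L2 \<psi>'_L2] L2_mult_integrable[OF V_mult_L2[OF \<psi>_L2] \<psi>_L2]
      by (simp add: F_def[abs_def] power2_eq_square mult.assoc)
    define h where "h x = 2 * c * (((deriv f x)\<^sup>2 - f x * g x) * s x) + (deriv f x)\<^sup>2 * (s x)\<^sup>2" for x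
    define h1 where "h1 x = indicator {- R..R} x * h x" for x
    have h1: "integrable lborel h1" "(LINT x|lborel. h1 x) = integral {- R..R} h"
      unfolding h1_def h_def by (intro compact continuous_intros profile_continuous g_continuous cs)+
    \<comment> \<open>The derivative \<open>T'\<close> absorbs every term of the form that contains
      \<open>k\<close> undifferentiated; its surplus \<open>2 c f g k'\<close> is compensated in
      \<open>h\<close>.\<close>
    define T where "T x = 2 * c * f x * g x * k x + deriv f x * g x * (k x)\<^sup>2" for x
    define T' where "T' x = 2 * c * (deriv f x * g x * k x + f x * (V x * deriv f x) * k x + f x * g x * S x)
      + (g x * g x * (k x)\<^sup>2 + deriv f x * (V x * deriv f x) * (k x)\<^sup>2 + deriv f x * g x * (2 * k x * S x))" for x
    have F_eq: "F x = c\<^sup>2 * w x + (T' x + h1 x)" for x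
    proof -
      have "h1 x = 2 * c * (((deriv f x)\<^sup>2 - f x * g x) * S x) + (deriv f x)\<^sup>2 * (S x)\<^sup>2"
        by (auto simp: h1_def h_def S_def indicator_def)
      then show ?thesis
        unfolding F_def \<psi>_def \<psi>'_def T'_def w_def
        by (simp add: power2_eq_square algebra_simps)
    qed
    \<comment> \<open>Integrability of \<open>T'\<close> is read off from the other terms of the
      decomposition \<open>F_eq\<close>.\<close>
    have "integrable lborel (\<lambda>x. F x - c\<^sup>2 * w x - h1 x)"
      by (intro Bochner_Integration.integrable_diff F_int integrable_mult_right w_integrable h1)
    then have T'_int: "integrable lborel T'"
      by (simp add: F_eq)
    have "(LINT x|lborel. T' x) = 0"
    proof (rule lebesgue_integral_derivative_vanishing_at_infinity[OF fin, of T])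
      show "continuous_on UNIV T"
        unfolding T_def by (intro continuous_intros ck profile_continuous g_continuous)
      show "(T has_real_derivative T' x) (at x)" if "x \<notin> {- R, R}" for x
      proof -
        have [derivative_intros]: "(k has_real_derivative S x) (at x)"
          using dk[OF off[OF that]] by (simp add: S_def)
        show ?thesis
          unfolding T_def T'_def
          by (rule derivative_eq_intros profile_deriv profile_deriv2_g g_deriv refl)+
            (simp add: power2_eq_square algebra_simps)
      qed
      have "((\<lambda>x. 2 * c * (k x * (f x * g x)) + (k x * deriv f x) * (k x * g x)) \<longlongrightarrow> 2 * c * 0 + 0 * 0) at_infinity"
        by (intro tendsto_intros k_lim profile_tendsto_0)
          (use tendsto_mult[OF profile_tendsto_0(1) profile_tendsto_0(3)] in simp)
      moreover have "(\<lambda>x. 2 * c * (k x * (f x * g x)) + (k x * deriv f x) * (k x * g x)) = T"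
        by (simp add: fun_eq_iff T_def power2_eq_square)
      ultimately show "(T \<longlongrightarrow> 0) at_infinity" by simp
    qed (rule T'_int)
    moreover have "L0_form p q f \<psi> \<psi>' = (LINT x|lborel. F x)"
      by (simp add: L0_form_def F_def V_def algebra_simps)
    moreover have "(LINT x|lborel. F x) = c\<^sup>2 * (LINT x|lborel. w x) + ((LINT x|lborel. T' x) + (LINT x|lborel. h1 x))"
      unfolding F_eq using w_integrable T'_int h1(1) by simp
    ultimately have L0: "L0_form p q f \<psi> \<psi>' = c\<^sup>2 * (LINT x|lborel. w x) + integral {- R..R} h"
      using h1 by simp
    \<comment> \<open>\<open>m\<close> is the cross term between \<open>f\<close> and
      \<open>k f'\<close>; integrating \<open>Z_deriv\<close> expresses its integral through
      \<open>Z\<close> at the ends and the integrals of \<open>f\<^sup>2\<close> and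
      \<open>w\<close>.\<close>
    define m where "m x = ((deriv f x)\<^sup>2 - f x * g x) * s x" for x
    have int_on: "u integrable_on {- R..R}" if "continuous_on {- R..R} u" for u :: "real \<Rightarrow> real"
      using that by (rule integrable_continuous_real)
    have Zi: "((\<lambda>x. m x + 2 * \<kappa> * (f x)\<^sup>2 + c\<^sub>0 * w x) has_integral (Z R - Z (- R))) {- R..R}"
      by (rule has_integral_FTC_finite_exceptions[of "{0}"])
        (use \<open>0 < R\<close> Z_deriv in \<open>auto simp: m_def w_def s_def intro!: Z_continuous\<close>)
    have wi: "((\<lambda>x. 2 * \<kappa> * (f x)\<^sup>2 + c\<^sub>0 * w x) has_integral
        2 * \<kappa> * integral {- R..R} (\<lambda>x. (f x)\<^sup>2) + c\<^sub>0 * integral {- R..R} w) {- R..R}"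
      by (intro has_integral_add has_integral_mult_right integrable_integral int_on
          continuous_intros profile_continuous w_continuous)
    have m: "(m has_integral (Z R - Z (- R) - (2 * \<kappa> * integral {- R..R} (\<lambda>x. (f x)\<^sup>2)
        + c\<^sub>0 * integral {- R..R} w))) {- R..R}"
      using has_integral_diff[OF Zi wi] by simp
    \<comment> \<open>\<open>\<rho>_identity\<close> turns the term quadratic in \<open>s\<close>
      into a linear one, at the cost of subtracting \<open>c\<^sub>0 m\<close>.\<close>
    have "h x = \<kappa> * ((f x)\<^sup>2 * s x) + (2 * c - c\<^sub>0) * m x" for x
    proof -
      have "(deriv f x)\<^sup>2 * s x = \<kappa> * (f x)\<^sup>2 + c\<^sub>0 * f x * g x - c\<^sub>0 * (deriv f x)\<^sup>2"
        using \<rho>_identity[of x] by (simp add: s_def algebra_simps)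
      then have "h x = 2 * c * m x + (\<kappa> * (f x)\<^sup>2 + c\<^sub>0 * f x * g x - c\<^sub>0 * (deriv f x)\<^sup>2) * s x"
        by (simp add: h_def m_def power2_eq_square[of "s x"])
      also have "\<dots> = \<kappa> * ((f x)\<^sup>2 * s x) + (2 * c - c\<^sub>0) * m x"
        by (simp add: m_def algebra_simps)
      finally show ?thesis .
    qed
    then have "h = (\<lambda>x. \<kappa> * ((f x)\<^sup>2 * s x) + (2 * c - c\<^sub>0) * m x)" by blast
    moreover have "((\<lambda>x. \<kappa> * ((f x)\<^sup>2 * s x) + (2 * c - c\<^sub>0) * m x) has_integral
        \<kappa> * A + (2 * c - c\<^sub>0) * (Z R - Z (- R) - (2 * \<kappa> * integral {- R..R} (\<lambda>x. (f x)\<^sup>2)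
        + c\<^sub>0 * integral {- R..R} w))) {- R..R}"
      unfolding A_def s_def[symmetric]
      by (intro has_integral_add has_integral_mult_right integrable_integral int_on m
          continuous_intros profile_continuous cs)
    ultimately have "integral {- R..R} h = \<kappa> * A + (2 * c - c\<^sub>0) * (Z R - Z (- R)
        - (2 * \<kappa> * integral {- R..R} (\<lambda>x. (f x)\<^sup>2) + c\<^sub>0 * integral {- R..R} w))"
      by (simp add: integral_unique)
    with L0 show ?thesis
      by (simp add: diff_diff_eq)
  qed
  ultimately show ?thesis
    using that[OF H1 weak] by (simp add: N_def)
qed

text \<open>In terms of \<open>y = c R - c\<^sub>0\<close> the form is \<open>y\<^sup>2 W - 2
  \<kappa> N y + (2 y + c\<^sub>0) (Z R - Z (- R) + E R)\<close>. The first term and the boundary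
  part are nonpositive, and \<open>E R\<close> tends to 0 while \<open>y\<close> stays above
  \<open>b > 0\<close>, so the linear term wins for large \<open>R\<close>.\<close>

lemma negative_direction:
  assumes "0 \<le> R\<^sub>0"
    and large: "2 * c\<^sub>0 * (LINT x|lborel. (f x)\<^sup>2) < integral {- R\<^sub>0..R\<^sub>0} (\<lambda>x. (f x)\<^sup>2 * (\<rho> x + \<gamma>))"
  shows "\<exists>\<psi> \<in> H1_rad. L2_inner \<psi> f = 0 \<and>
           (\<exists>\<psi>'. has_L2_weak_derivative \<psi> \<psi>' \<and> L0_form p q f \<psi> \<psi>' < 0)"
proof -
  define N W A where "N = (LINT x|lborel. (f x)\<^sup>2)" and "W = (LINT x|lborel. w x)"
    and "A R = integral {- R..R} (\<lambda>x. (f x)\<^sup>2 * (\<rho> x + \<gamma>))" for R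
  define E where "E R = 2 * \<kappa> * (N - integral {- R..R} (\<lambda>x. (f x)\<^sup>2)) + c\<^sub>0 * (W - integral {- R..R} w)" for R
  have int: "(\<lambda>x. (f x)\<^sup>2 * (\<rho> x + \<gamma>)) integrable_on {u..v}" "(\<lambda>x. (f x)\<^sup>2) integrable_on {u..v}" for u v
    by (intro integrable_continuous_real continuous_intros profile_continuous \<rho>_continuous)+
  have "0 < N"
  proof -
    have "0 < integral {0..1::real} (\<lambda>x. (f 1)\<^sup>2)"
      using profile_pos[of 1] by simp
    also have "\<dots> \<le> integral {0..1} (\<lambda>x. (f x)\<^sup>2)"
    proof (intro integral_le int ballI)
      fix x :: real assume "x \<in> {0..1}"
      then have "f 1 \<le> f x"
        using ground_state_strict_decreasing[OF profile, of x 1] by (cases "x = 1") auto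
      then show "(f 1)\<^sup>2 \<le> (f x)\<^sup>2"
        using profile_pos[of 1] by (intro power_mono) auto
    qed auto
    finally have "0 < 2 * integral {0..1} (\<lambda>x. (f x)\<^sup>2)" by simp
    also have "\<dots> \<le> N"
      unfolding N_def
      by (intro integral_interval_le_lebesgue_integral_even profile_squared_integrable continuous_intros
          profile_continuous) (simp_all add: profile_even)
    finally show ?thesis .
  qed
  \<comment> \<open>This coefficient makes the trial function orthogonal to
    \<open>f\<close>.\<close>
  define c where "c R = A R / (2 * N)" for R
  define b where "b = c R\<^sub>0 - c\<^sub>0"
  have "0 < b"
    using large \<open>0 < N\<close> by (simp add: b_def c_def A_def N_def field_simps)
  have c_mono: "c R\<^sub>0 \<le> c R" if "R\<^sub>0 \<le> R" for R
    unfolding c_def A_def using that \<open>0 < N\<close> \<rho>_pos[THEN less_imp_le] \<gamma>_pos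
    by (intro divide_right_mono integral_subset_le int ballI mult_nonneg_nonneg add_nonneg_nonneg) auto
  \<comment> \<open>\<open>K\<close> is chosen so that \<open>2 y + c\<^sub>0 \<le> K y\<close> for
    every \<open>y \<ge> b\<close>; then an error below \<open>2 \<kappa> N / K\<close> is small
    enough.\<close>
  define K where "K = 2 + c\<^sub>0 / b"
  have "0 < K" using c\<^sub>0_pos \<open>0 < b\<close> by (simp add: K_def add_pos_pos)
  have "(\<lambda>n. E (real n)) \<longlonglongrightarrow> 2 * \<kappa> * (N - N) + c\<^sub>0 * (W - W)"
    unfolding E_def N_def W_def
    by (intro tendsto_intros integrable_tendsto_symmetric_intervals profile_squared_integrable w_integrable)
  then have "(\<lambda>n. \<bar>E (real n)\<bar>) \<longlonglongrightarrow> \<bar>2 * \<kappa> * (N - N) + c\<^sub>0 * (W - W)\<bar>"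
    by (rule tendsto_rabs)
  then have "\<forall>\<^sub>F n in sequentially. \<bar>E (real n)\<bar> < 2 * \<kappa> * N / K"
    by (rule order_tendstoD) (use \<kappa>_pos \<open>0 < N\<close> \<open>0 < K\<close> in simp)
  moreover have "\<forall>\<^sub>F n in sequentially. max 1 R\<^sub>0 \<le> real n"
    by (rule filterlim_real_sequentially[unfolded filterlim_at_top, rule_format])
  ultimately have "\<forall>\<^sub>F n in sequentially. \<bar>E (real n)\<bar> < 2 * \<kappa> * N / K \<and> max 1 R\<^sub>0 \<le> real n"
    by (rule eventually_conj)
  then obtain n where n: "\<bar>E (real n)\<bar> < 2 * \<kappa> * N / K" "max 1 R\<^sub>0 \<le> real n"
    by (auto dest!: eventually_happens)
  define R y where "R = real n" and "y = c R - c\<^sub>0"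
  have R: "\<bar>E R\<bar> < 2 * \<kappa> * N / K" "0 < R" "R\<^sub>0 \<le> R"
    using n by (auto simp: R_def)
  have "b \<le> y" using c_mono[OF \<open>R\<^sub>0 \<le> R\<close>] by (simp add: b_def y_def)
  with \<open>0 < b\<close> have "0 < y" by simp
  obtain \<psi> \<psi>' where \<psi>: "\<psi> \<in> H1_rad" "has_L2_weak_derivative \<psi> \<psi>'"
    and orth: "L2_inner \<psi> f = c R * N - A R / 2"
    and form: "L0_form p q f \<psi> \<psi>' = (c R)\<^sup>2 * W + \<kappa> * A R
      + (2 * c R - c\<^sub>0) * (Z R - Z (- R) - 2 * \<kappa> * integral {- R..R} (\<lambda>x. (f x)\<^sup>2) - c\<^sub>0 * integral {- R..R} w)"
    by (rule trial_function[OF \<open>0 < R\<close>, of "c R", folded N_def W_def A_def])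
  have AR: "A R = 2 * N * c R"
    using \<open>0 < N\<close> by (simp add: c_def)
  have cR: "c R = y + c\<^sub>0" by (simp add: y_def)
  have "L0_form p q f \<psi> \<psi>' = y\<^sup>2 * W - 2 * \<kappa> * N * y + (2 * y + c\<^sub>0) * (Z R - Z (- R) + E R)"
    unfolding form AR cR E_def by algebra
  moreover have "y\<^sup>2 * W \<le> 0"
    using w_integral_nonpos by (simp add: W_def mult_nonneg_nonpos)
  moreover have "(2 * y + c\<^sub>0) * (Z R - Z (- R) + E R) \<le> (2 * y + c\<^sub>0) * \<bar>E R\<bar>"
    using \<open>0 < y\<close> c\<^sub>0_pos Z_odd_nonpos[of R] \<open>0 < R\<close> by (intro mult_left_mono) auto
  moreover have "(2 * y + c\<^sub>0) * \<bar>E R\<bar> \<le> (y * K) * \<bar>E R\<bar>"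
  proof (rule mult_right_mono)
    have "c\<^sub>0 = b * (c\<^sub>0 / b)" using \<open>0 < b\<close> by simp
    also have "\<dots> \<le> y * (c\<^sub>0 / b)"
      using \<open>b \<le> y\<close> \<open>0 < b\<close> c\<^sub>0_pos by (intro mult_right_mono) auto
    finally show "2 * y + c\<^sub>0 \<le> y * K" by (simp add: K_def distrib_left)
  qed simp
  moreover have "(y * K) * \<bar>E R\<bar> < 2 * \<kappa> * N * y"
    using R(1) \<open>0 < K\<close> \<open>0 < y\<close> by (simp add: pos_less_divide_eq mult_ac)
  ultimately have "L0_form p q f \<psi> \<psi>' < 0" by linarith
  moreover have "L2_inner \<psi> f = 0"
    unfolding orth AR by simp
  ultimately show ?thesis using \<psi> by blast
qed

subsection \<open>Comparison with positive frequencies\<close>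

lemma profile_integral_le: "0 \<le> Y \<Longrightarrow> 2 * integral {0..Y} (\<lambda>y. (f y)\<^sup>2) \<le> (LINT x|lborel. (f x)\<^sup>2)"
  by (intro integral_interval_le_lebesgue_integral_even profile_squared_integrable continuous_intros
      profile_continuous) (simp_all add: profile_even)

context
  fixes \<omega> :: real and u :: "real \<Rightarrow> real"
  assumes \<omega>: "0 \<le> \<omega>" and gs: "ground_state p q \<omega> u"
begin

definition \<theta> :: real where "\<theta> = u 0 / f 0"

lemma \<theta>_pos: "0 < \<theta>" and u_0_eq: "u 0 = \<theta> * f 0"
  using ground_state_pos[OF gs, of 0] profile_pos[of 0] by (auto simp: \<theta>_def)

text \<open>In the amplitude relation of \<open>u\<close>, rescaling by \<open>f 0\<close> gives
  both powers of \<open>\<theta>\<close> the same coefficient \<open>\<kappa>\<close>.\<close>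

lemma \<omega>_eq: "\<omega> = \<kappa> * (\<theta> powr (q - 1) - \<theta> powr (p - 1))"
proof -
  have "\<omega> = 2 / (q + 1) * u 0 powr (q - 1) - 2 / (p + 1) * u 0 powr (p - 1)"
    using p_gt_1 p_less_q by (intro ground_state_amplitude[OF gs]) auto
  also have "2 / (q + 1) * u 0 powr (q - 1) = \<theta> powr (q - 1) * \<kappa>"
    using \<theta>_pos profile_pos[of 0] by (simp add: u_0_eq powr_mult \<kappa>_eq)
  also have "2 / (p + 1) * u 0 powr (p - 1) = \<theta> powr (p - 1) * \<kappa>"
    using \<theta>_pos profile_pos[of 0] by (simp add: u_0_eq powr_mult \<kappa>_def)
  finally show ?thesis by (simp add: algebra_simps)
qed

lemma \<theta>_ge_1: "1 \<le> \<theta>"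
proof (rule ccontr)
  assume "\<not> 1 \<le> \<theta>"
  then have "\<theta> powr (q - 1) < \<theta> powr (p - 1)"
    using \<theta>_pos p_less_q by (intro powr_less_mono') auto
  then have "\<omega> < 0"
    using \<kappa>_pos by (simp add: \<omega>_eq mult_pos_neg)
  with \<omega> show False by simp
qed

text \<open>The ratio of \<open>(u' / u)^2\<close> at \<open>X y\<close> to
  \<open>(f' / f)^2\<close> at \<open>y\<close>, for \<open>y > 0\<close>.\<close>

definition z :: "real \<Rightarrow> real" where
  "z y = \<theta> powr (p - 1) + (\<theta> powr (q - 1) - \<theta> powr (p - 1)) * \<rho> y"

lemma \<theta>_powr: "1 \<le> \<theta> powr (p - 1)" "\<theta> powr (p - 1) \<le> \<theta> powr (q - 1)"
  using \<theta>_ge_1 p_gt_1 p_less_q by (auto intro: ge_one_powr_ge_zero powr_mono)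

lemma z_ge_1: "1 \<le> z y"
  using \<theta>_powr \<rho>_pos[of y] by (auto simp: z_def intro!: add_increasing2 mult_nonneg_nonneg)

text \<open>The point of the half-line where \<open>u\<close> has the value
  \<open>\<theta> f y\<close>; it serves as a change of variables.\<close>

definition X :: "real \<Rightarrow> real" where
  "X y = level_position u (\<theta> * f y)"

lemma level_bounds: "0 < \<theta> * f y" "\<theta> * f y \<le> u 0"
  using \<theta>_pos profile_pos[of y] ground_state_le_0[OF profile, of y] by (auto simp: u_0_eq)

lemma X_nonneg: "0 \<le> X y" and u_X: "u (X y) = \<theta> * f y"
  unfolding X_def using level_position[OF p_gt_1 p_less_q \<omega> gs level_bounds] by auto

lemma X_0: "X 0 = 0"
  unfolding X_def u_0_eq[symmetric] by (rule level_position_of_value[OF p_gt_1 p_less_q \<omega> gs]) simp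

lemma X_surj: "0 \<le> x \<Longrightarrow> \<exists>y\<ge>0. X y = x"
proof -
  assume "0 \<le> x"
  have "0 < u x / \<theta>" "u x / \<theta> \<le> f 0"
    using ground_state_pos[OF gs, of x] ground_state_le_0[OF gs, of x] \<theta>_pos
    by (auto simp: u_0_eq pos_divide_le_eq mult.commute)
  then obtain y where "0 \<le> y" "f y = u x / \<theta>"
    using ground_state_level[OF profile] by blast
  then have "X y = level_position u (u x)"
    using \<theta>_pos by (simp add: X_def)
  with \<open>0 \<le> y\<close> \<open>0 \<le> x\<close> show ?thesis
    using level_position_of_value[OF p_gt_1 p_less_q \<omega> gs] by auto
qed

lemma X_continuous: "continuous_on {0..Y} X"
proof (cases "0 \<le> Y")
  case True
  have "continuous_on {\<theta> * f Y..u 0} (level_position u)"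
    by (rule level_position_continuous[OF p_gt_1 p_less_q \<omega> gs level_bounds(1)])
  then show ?thesis
    unfolding X_def
  proof (rule continuous_on_compose2)
    show "(\<lambda>y. \<theta> * f y) ` {0..Y} \<subseteq> {\<theta> * f Y..u 0}"
    proof (rule image_subsetI)
      fix y assume "y \<in> {0..Y}"
      then have "f Y \<le> f y"
        using ground_state_strict_decreasing[OF profile, of y Y] by (cases "y = Y") auto
      then show "\<theta> * f y \<in> {\<theta> * f Y..u 0}"
        using \<theta>_pos level_bounds(2) by simp
    qed
  qed (intro continuous_intros profile_continuous)
qed simp

text \<open>The first integrals of \<open>u\<close> and \<open>f\<close> are compared at matched
  levels; in the chain rule everything but \<open>sqrt z\<close> cancels.\<close>

lemma X_deriv:
  assumes "0 < y"
  shows "(X has_real_derivative 1 / sqrt (z y)) (at y)"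
proof -
  have lt: "\<theta> * f y < u 0"
    using ground_state_less_0[OF profile, of y] assms \<theta>_pos by (simp add: u_0_eq)
  then have "X y \<noteq> 0"
    using u_X[of y] by auto
  then have "0 < X y"
    using X_nonneg[of y] by simp
  have nz: "0 < f y" "0 < D y" "0 < z y"
    using profile_pos D_pos[of y] z_ge_1[of y] assms by auto
  have "(deriv u (X y))\<^sup>2 = (\<theta> * f y)\<^sup>2 * (D y * z y)"
  proof -
    have "(deriv u (X y))\<^sup>2 = (\<theta> * f y)\<^sup>2 * (\<omega> + 2 / (p + 1) * (\<theta> * f y) powr (p - 1)
        - 2 / (q + 1) * (\<theta> * f y) powr (q - 1))"
      using ground_state_first_integral[OF gs, of "X y"] p_gt_1 p_less_q by (simp add: u_X)
    also have "\<omega> + 2 / (p + 1) * (\<theta> * f y) powr (p - 1) - 2 / (q + 1) * (\<theta> * f y) powr (q - 1)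
      = \<theta> powr (p - 1) * D y + (\<theta> powr (q - 1) - \<theta> powr (p - 1)) * (\<kappa> - 2 / (q + 1) * f y powr (q - 1))"
      using \<theta>_pos nz by (simp add: powr_mult \<omega>_eq D_def algebra_simps)
    also have "\<kappa> - 2 / (q + 1) * f y powr (q - 1) = D y * \<rho> y"
      using nz assms by (simp add: \<rho>_def)
    finally show ?thesis by (simp add: z_def algebra_simps)
  qed
  then have "sqrt ((deriv u (X y))\<^sup>2) = sqrt ((\<theta> * f y)\<^sup>2 * (D y * z y))" by simp
  then have "\<bar>deriv u (X y)\<bar> = \<theta> * f y * (sqrt (D y) * sqrt (z y))"
    using \<theta>_pos nz by (simp add: real_sqrt_mult)
  with ground_state_deriv_neg[OF gs p_gt_1 p_less_q \<omega> \<open>0 < X y\<close>]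
  have du: "deriv u (X y) = - \<theta> * f y * (sqrt (D y) * sqrt (z y))" by simp
  have "(X has_real_derivative inverse (deriv u (X y)) * (\<theta> * deriv f y)) (at y)"
    unfolding X_def
    by (rule DERIV_chain2[OF level_position_deriv[OF p_gt_1 p_less_q \<omega> gs level_bounds(1) lt]
          DERIV_cmult[OF profile_deriv]])
  then show ?thesis
    by (rule DERIV_cong) (use \<theta>_pos nz in \<open>simp add: du deriv_eq_sqrt[OF assms] field_simps\<close>)
qed

text \<open>Substitution \<open>x = X y\<close>: the primitive \<open>U\<close> of
  \<open>u\<^sup>2\<close> is composed with \<open>X\<close>, and at the endpoint 0 only continuity
  is used.\<close>

lemma has_integral_substitution_level:
  assumes "0 \<le> Y"
  shows "((\<lambda>y. (\<theta> * f y)\<^sup>2 / sqrt (z y)) has_integral integral {0..X Y} (\<lambda>x. (u x)\<^sup>2)) {0..Y}"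
proof -
  define U where "U x = integral {0..x} (\<lambda>x. (u x)\<^sup>2)" for x
  have cu: "continuous_on B (\<lambda>x. (u x)\<^sup>2)" for B
    by (intro continuous_intros ground_state_continuous[OF gs])
  have cU: "continuous_on {0..m} U" for m
    unfolding U_def by (intro indefinite_integral_continuous_1 integrable_continuous_real cu)
  have dU: "(U has_real_derivative (u x)\<^sup>2) (at x)" if "0 < x" for x
  proof -
    have "(U has_real_derivative (u x)\<^sup>2) (at x within {0..x + 1})"
      unfolding U_def by (rule integral_has_real_derivative[OF cu]) (use that in auto)
    moreover have "at x within {0..x + 1} = at x"
      using that by (intro at_within_interior) auto
    ultimately show ?thesis by simp
  qed
  obtain m where m: "\<forall>y\<in>{0..Y}. X y \<le> m"
    using continuous_attains_sup[of "{0..Y}" X] X_continuous \<open>0 \<le> Y\<close> by force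
  have "((\<lambda>y. (\<theta> * f y)\<^sup>2 / sqrt (z y)) has_integral U (X Y) - U (X 0)) {0..Y}"
  proof (rule has_integral_FTC_finite_exceptions[of "{}"])
    show "continuous_on {0..Y} (\<lambda>y. U (X y))"
      by (rule continuous_on_compose2[OF cU[of m] X_continuous]) (use m X_nonneg in auto)
    fix y :: real assume "0 < y"
    then have "X y \<noteq> 0"
      using u_X[of y] ground_state_less_0[OF profile, of y] \<theta>_pos u_0_eq by auto
    then have "0 < X y"
      using X_nonneg[of y] by simp
    from DERIV_chain2[OF dU[OF this] X_deriv[OF \<open>0 < y\<close>]]
    show "((\<lambda>y. U (X y)) has_real_derivative (\<theta> * f y)\<^sup>2 / sqrt (z y)) (at y)"
      by (simp add: u_X)
  qed (use \<open>0 \<le> Y\<close> in auto)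
  then show ?thesis by (simp add: X_0 U_def)
qed

section \<open>Bounds for the mass in terms of the amplitude ratio\<close>

lemma integral_upper_bound:
  assumes "0 \<le> x"
  shows "2 * integral {0..x} (\<lambda>x. (u x)\<^sup>2) \<le> \<theta>\<^sup>2 * (LINT x|lborel. (f x)\<^sup>2)"
proof -
  \<comment> \<open>Every point of the half-line is matched, so a bound in the variable
    \<open>y\<close>, here from \<open>1 \<le> z\<close>, reaches all \<open>x\<close>.\<close>
  obtain Y where Y: "0 \<le> Y" "X Y = x" using X_surj[OF assms] by blast
  have "integral {0..x} (\<lambda>x. (u x)\<^sup>2) \<le> \<theta>\<^sup>2 * integral {0..Y} (\<lambda>y. (f y)\<^sup>2)"
  proof (rule has_integral_le)
    show "((\<lambda>y. (\<theta> * f y)\<^sup>2 / sqrt (z y)) has_integral integral {0..x} (\<lambda>x. (u x)\<^sup>2)) {0..Y}"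
      using has_integral_substitution_level[OF Y(1)] Y(2) by simp
    show "((\<lambda>y. \<theta>\<^sup>2 * (f y)\<^sup>2) has_integral \<theta>\<^sup>2 * integral {0..Y} (\<lambda>y. (f y)\<^sup>2)) {0..Y}"
      by (intro has_integral_mult_right integrable_integral integrable_continuous_real continuous_intros
          profile_continuous)
    fix y
    have "(\<theta> * f y)\<^sup>2 / sqrt (z y) \<le> (\<theta> * f y)\<^sup>2 / 1"
      using z_ge_1[of y] by (intro divide_left_mono) auto
    then show "(\<theta> * f y)\<^sup>2 / sqrt (z y) \<le> \<theta>\<^sup>2 * (f y)\<^sup>2"
      by (simp add: power_mult_distrib)
  qed
  moreover have "\<theta>\<^sup>2 * (2 * integral {0..Y} (\<lambda>y. (f y)\<^sup>2)) \<le> \<theta>\<^sup>2 * (LINT x|lborel. (f x)\<^sup>2)"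
    by (intro mult_left_mono profile_integral_le Y) simp
  ultimately show ?thesis by simp
qed

lemma ground_state_squared_integrable: "integrable lborel (\<lambda>x. (u x)\<^sup>2)"
proof (rule integrable_even_of_bounded_integrals)
  show "integral {0..x} (\<lambda>x. (u x)\<^sup>2) \<le> \<theta>\<^sup>2 * (LINT x|lborel. (f x)\<^sup>2) / 2" if "0 \<le> x" for x
    using integral_upper_bound[OF that] by simp
qed (auto intro!: continuous_intros ground_state_continuous[OF gs] simp: ground_state_even[OF gs])

lemma mass_upper_bound: "mass u \<le> \<theta>\<^sup>2 * mass f"
proof -
  have "(\<lambda>n. 2 * integral {0..real n} (\<lambda>x. (u x)\<^sup>2)) \<longlonglongrightarrow> (LINT x|lborel. (u x)\<^sup>2)"
    by (intro tendsto_integral_interval_even ground_state_squared_integrable continuous_intros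
        ground_state_continuous[OF gs]) (simp add: ground_state_even[OF gs])
  then have "(LINT x|lborel. (u x)\<^sup>2) \<le> \<theta>\<^sup>2 * (LINT x|lborel. (f x)\<^sup>2)"
    by (rule LIMSEQ_le_const2) (use integral_upper_bound in auto)
  then show ?thesis by (simp add: mass_def)
qed

text \<open>Replacing \<open>1 / sqrt z\<close> by its tangent at 1 makes the integrand affine in
  \<open>\<rho>\<close> with nonpositive coefficient, so the upper bound \<open>small\<close> on the
  weighted integral yields a lower bound on the mass.\<close>

lemma mass_lower_bound:
  assumes small: "\<And>R. 0 \<le> R \<Longrightarrow>
    integral {- R..R} (\<lambda>x. (f x)\<^sup>2 * (\<rho> x + \<gamma>)) \<le> 2 * c\<^sub>0 * (LINT x|lborel. (f x)\<^sup>2)"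
  shows "\<theta>\<^sup>2 * ((3 - \<theta> powr (p - 1)) / 2
      - (5 - p) / (2 * (q - p)) * (\<theta> powr (q - 1) - \<theta> powr (p - 1))) * mass f \<le> mass u"
proof -
  define N I where "N = (LINT x|lborel. (f x)\<^sup>2)" and "I Y = integral {0..Y} (\<lambda>x. (f x)\<^sup>2)" for Y
  define \<Delta> where "\<Delta> = \<theta> powr (q - 1) - \<theta> powr (p - 1)"
  have "0 \<le> \<Delta>" using \<theta>_powr by (simp add: \<Delta>_def)
  have int: "(\<lambda>x. (f x)\<^sup>2) integrable_on {0..Y}" "(\<lambda>x. (f x)\<^sup>2 * \<rho> x) integrable_on {0..Y}" for Y
    by (intro integrable_continuous_real continuous_intros profile_continuous \<rho>_continuous)+
  have bound: "\<theta>\<^sup>2 * ((3 - \<theta> powr (p - 1)) * I Y - \<Delta> * (c\<^sub>0 * N - \<gamma> * I Y)) \<le> (LINT x|lborel. (u x)\<^sup>2)"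
    if "0 \<le> Y" for Y
  proof -
    define J where "J = integral {0..Y} (\<lambda>x. (f x)\<^sup>2 * \<rho> x)"
    have "integral {- Y..Y} (\<lambda>x. (f x)\<^sup>2 * (\<rho> x + \<gamma>)) = 2 * integral {0..Y} (\<lambda>x. (f x)\<^sup>2 * (\<rho> x + \<gamma>))"
      by (intro integral_symmetric_interval_even continuous_intros profile_continuous \<rho>_continuous that)
        (simp add: profile_even \<rho>_even)
    also have "integral {0..Y} (\<lambda>x. (f x)\<^sup>2 * (\<rho> x + \<gamma>)) = J + \<gamma> * I Y"
    proof (rule integral_unique)
      have "((\<lambda>x. (f x)\<^sup>2 * \<rho> x + \<gamma> * (f x)\<^sup>2) has_integral J + \<gamma> * I Y) {0..Y}"
        unfolding J_def I_def by (intro has_integral_add has_integral_mult_right integrable_integral int)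
      then show "((\<lambda>x. (f x)\<^sup>2 * (\<rho> x + \<gamma>)) has_integral J + \<gamma> * I Y) {0..Y}"
        by (simp add: algebra_simps)
    qed
    finally have J: "J \<le> c\<^sub>0 * N - \<gamma> * I Y"
      using small[OF that] by (simp add: N_def)
    have "\<theta>\<^sup>2 * ((3 - \<theta> powr (p - 1)) / 2 * I Y - \<Delta> / 2 * J) \<le> integral {0..X Y} (\<lambda>x. (u x)\<^sup>2)"
    proof (rule has_integral_le)
      show "((\<lambda>y. \<theta>\<^sup>2 * ((3 - \<theta> powr (p - 1)) / 2 * (f y)\<^sup>2 - \<Delta> / 2 * ((f y)\<^sup>2 * \<rho> y))) has_integral
          \<theta>\<^sup>2 * ((3 - \<theta> powr (p - 1)) / 2 * I Y - \<Delta> / 2 * J)) {0..Y}"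
        unfolding J_def I_def by (intro has_integral_diff has_integral_mult_right integrable_integral int)
      show "((\<lambda>y. (\<theta> * f y)\<^sup>2 / sqrt (z y)) has_integral integral {0..X Y} (\<lambda>x. (u x)\<^sup>2)) {0..Y}"
        by (rule has_integral_substitution_level[OF that])
      fix y
      \<comment> \<open>\<open>s \<mapsto> 1 / sqrt s\<close> lies above its tangent at 1.\<close>
      have "(3 - s\<^sup>2) / 2 \<le> 1 / s" if "0 < s" for s :: real
      proof -
        have "0 \<le> (s - 1)\<^sup>2 * (s + 2)" using that by simp
        then have "(3 - s\<^sup>2) * s \<le> 2" by (simp add: power2_eq_square algebra_simps)
        then show ?thesis using that by (simp add: field_simps)
      qed
      from this[of "sqrt (z y)"] have "(3 - z y) / 2 \<le> 1 / sqrt (z y)"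
        using z_ge_1[of y] by simp
      then have "(\<theta> * f y)\<^sup>2 * ((3 - z y) / 2) \<le> (\<theta> * f y)\<^sup>2 * (1 / sqrt (z y))"
        by (rule mult_left_mono) simp
      then show "\<theta>\<^sup>2 * ((3 - \<theta> powr (p - 1)) / 2 * (f y)\<^sup>2 - \<Delta> / 2 * ((f y)\<^sup>2 * \<rho> y))
          \<le> (\<theta> * f y)\<^sup>2 / sqrt (z y)"
        by (simp add: z_def \<Delta>_def[symmetric] power_mult_distrib field_simps)
    qed
    also have "2 * integral {0..X Y} (\<lambda>x. (u x)\<^sup>2) \<le> (LINT x|lborel. (u x)\<^sup>2)"
      by (intro integral_interval_le_lebesgue_integral_even ground_state_squared_integrable continuous_intros
        ground_state_continuous[OF gs] X_nonneg) (simp_all add: ground_state_even[OF gs])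
    finally have "\<theta>\<^sup>2 * ((3 - \<theta> powr (p - 1)) * I Y - \<Delta> * J) \<le> (LINT x|lborel. (u x)\<^sup>2)"
      by (simp add: algebra_simps)
    moreover have "\<theta>\<^sup>2 * ((3 - \<theta> powr (p - 1)) * I Y - \<Delta> * (c\<^sub>0 * N - \<gamma> * I Y))
        \<le> \<theta>\<^sup>2 * ((3 - \<theta> powr (p - 1)) * I Y - \<Delta> * J)"
      using J \<open>0 \<le> \<Delta>\<close> by (intro mult_left_mono diff_left_mono) auto
    ultimately show ?thesis by simp
  qed
  \<comment> \<open>Passing to the limit in \<open>bound\<close> replaces \<open>2 * I Y\<close> by
    \<open>N\<close>, which keeps the constants sharp.\<close>
  have "(\<lambda>n. 2 * I (real n)) \<longlonglongrightarrow> N"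
    unfolding I_def N_def
    by (intro tendsto_integral_interval_even profile_squared_integrable continuous_intros
        profile_continuous) (simp add: profile_even)
  then have "(\<lambda>n. 2 * I (real n) / 2) \<longlonglongrightarrow> N / 2"
    by (intro tendsto_intros) auto
  then have "(\<lambda>n. \<theta>\<^sup>2 * ((3 - \<theta> powr (p - 1)) * I (real n) - \<Delta> * (c\<^sub>0 * N - \<gamma> * I (real n))))
      \<longlonglongrightarrow> \<theta>\<^sup>2 * ((3 - \<theta> powr (p - 1)) * (N / 2) - \<Delta> * (c\<^sub>0 * N - \<gamma> * (N / 2)))"
    by (intro tendsto_intros) simp_all
  then have "\<theta>\<^sup>2 * ((3 - \<theta> powr (p - 1)) * (N / 2) - \<Delta> * (c\<^sub>0 * N - \<gamma> * (N / 2))) \<le> (LINT x|lborel. (u x)\<^sup>2)"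
    by (rule LIMSEQ_le_const2) (use bound in auto)
  \<comment> \<open>This value of \<open>c\<^sub>0 - \<gamma> / 2\<close> is what later makes the
    derivative of the bound vanish at \<open>\<theta> = 1\<close>.\<close>
  moreover have "c\<^sub>0 * N - \<gamma> * (N / 2) = (5 - p) / (2 * (q - p)) * N"
  proof -
    define d where "d = q - p"
    have "0 < d" using p_less_q by (simp add: d_def)
    have "c\<^sub>0 - \<gamma> / 2 = 2 / d - (p - 1) / d / 2"
      by (simp add: c\<^sub>0_def \<gamma>_def d_def)
    also have "\<dots> = (5 - p) / (2 * d)"
      using \<open>0 < d\<close> by (simp add: divide_simps)
    finally have "(5 - p) / (2 * (q - p)) = c\<^sub>0 - \<gamma> / 2" by (simp add: d_def)
    then show ?thesis by (simp only:) (simp add: algebra_simps)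
  qed
  ultimately have "\<theta>\<^sup>2 * ((3 - \<theta> powr (p - 1)) * (N / 2) - \<Delta> * ((5 - p) / (2 * (q - p)) * N))
      \<le> (LINT x|lborel. (u x)\<^sup>2)"
    by simp
  moreover have "\<theta>\<^sup>2 * (a * (N / 2) - \<Delta> * (e * N)) = 2 * (\<theta>\<^sup>2 * (a / 2 - e * \<Delta>) * (1 / 2 * N))" for a e
    by (simp add: algebra_simps)
  ultimately show ?thesis
    unfolding mass_def N_def[symmetric] \<Delta>_def[symmetric] by (simp only:)
qed

end

end

section \<open>Contradiction between the mass bounds and a negative slope at zero frequency\<close>

theorem theorem1p3:
  fixes p q :: real and \<phi> :: "real \<Rightarrow> real \<Rightarrow> real" and M'0 :: ereal
  assumes "1 < p" and "p < q" and "q < 5"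
    and "\<And>\<omega>. 0 \<le> \<omega> \<Longrightarrow> ground_state p q \<omega> (\<phi> \<omega>)"
    and "\<forall>\<^sub>F \<omega> in at_right 0. (\<lambda>\<omega>. mass (\<phi> \<omega>)) differentiable (at \<omega>)"
    and "((\<lambda>\<omega>. ereal (deriv (\<lambda>\<omega>. mass (\<phi> \<omega>)) \<omega>)) \<longlongrightarrow> M'0) (at_right 0)"
    and "M'0 < 0"
  shows "\<exists>\<psi> \<in> H1_rad. L2_inner \<psi> (\<phi> 0) = 0 \<and>
           (\<exists>\<psi>'. has_L2_weak_derivative \<psi> \<psi>' \<and> L0_form p q (\<phi> 0) \<psi> \<psi>' < 0)"
proof -
  note gs = assms(4)
  interpret double_power_profile p q "\<phi> 0"
    using assms(1-3) gs[of 0] by unfold_locales auto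
  show ?thesis
  proof (rule ccontr)
    assume no_direction: "\<not> ?thesis"
    \<comment> \<open>The contrapositive of \<open>negative_direction\<close> supplies the
      hypothesis of the lower mass bound.\<close>
    have small: "integral {- R..R} (\<lambda>x. (\<phi> 0 x)\<^sup>2 * (\<rho> x + \<gamma>)) \<le> 2 * c\<^sub>0 * (LINT x|lborel. (\<phi> 0 x)\<^sup>2)"
      if "0 \<le> R" for R
      using negative_direction[OF that] no_direction by linarith
    define m where "m \<omega> = mass (\<phi> \<omega>)" for \<omega>
    define \<theta>' where "\<theta>' \<omega> = \<theta> (\<phi> \<omega>)" for \<omega>
    have \<theta>_ge: "1 \<le> \<theta>' \<omega>"
      and \<omega>_eq: "\<omega> = \<kappa> * (\<theta>' \<omega> powr (q - 1) - \<theta>' \<omega> powr (p - 1))"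
      and upper: "m \<omega> \<le> (\<theta>' \<omega>)\<^sup>2 * m 0"
      and lower: "(\<theta>' \<omega>)\<^sup>2 * ((3 - \<theta>' \<omega> powr (p - 1)) / 2
          - (5 - p) / (2 * (q - p)) * (\<theta>' \<omega> powr (q - 1) - \<theta>' \<omega> powr (p - 1))) * m 0 \<le> m \<omega>"
      if "0 \<le> \<omega>" for \<omega>
      using \<theta>_ge_1[OF that gs[OF that]] \<omega>_eq[OF that gs[OF that]] mass_upper_bound[OF that gs[OF that]]
        mass_lower_bound[OF that gs[OF that] small]
      by (simp_all add: \<theta>'_def m_def)
    \<comment> \<open>Squeezing: \<open>\<omega> / \<kappa>\<close> is
      \<open>\<theta>^(p-1) (\<theta>^(q-p) - 1)\<close>, which is at least
      \<open>\<theta>^(q-p) - 1\<close> because \<open>\<theta> \<ge> 1\<close>.\<close>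
    have \<theta>_lim: "(\<theta>' \<longlongrightarrow> 1) (at_right 0)"
    proof (rule tendsto_sandwich)
      show "\<forall>\<^sub>F \<omega> in at_right 0. 1 \<le> \<theta>' \<omega>"
        using \<theta>_ge by (auto simp: eventually_at_filter intro!: always_eventually)
      have "\<theta>' \<omega> \<le> (1 + \<omega> / \<kappa>) powr (1 / (q - p))" if "0 < \<omega>" for \<omega>
      proof -
        let ?t = "\<theta>' \<omega>"
        have t: "1 \<le> ?t" using \<theta>_ge that by simp
        have "1 \<le> ?t powr (q - p)" "1 \<le> ?t powr (p - 1)"
          using t assms(1,2) by (auto intro: ge_one_powr_ge_zero)
        then have "?t powr (q - p) - 1 \<le> ?t powr (p - 1) * (?t powr (q - p) - 1)"
          using mult_right_mono[of 1 "?t powr (p - 1)" "?t powr (q - p) - 1"] by simp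
        also have "\<dots> = ?t powr (q - 1) - ?t powr (p - 1)"
          by (simp add: right_diff_distrib flip: powr_add)
        also have "\<dots> = \<omega> / \<kappa>"
          using \<omega>_eq[of \<omega>] that \<kappa>_pos by (simp add: field_simps)
        finally have "?t powr (q - p) \<le> 1 + \<omega> / \<kappa>" by simp
        then have "(?t powr (q - p)) powr (1 / (q - p)) \<le> (1 + \<omega> / \<kappa>) powr (1 / (q - p))"
          using assms(2) by (intro powr_mono2) auto
        then show ?thesis
          using t assms(2) by (simp add: powr_powr)
      qed
      then show "\<forall>\<^sub>F \<omega> in at_right 0. \<theta>' \<omega> \<le> (1 + \<omega> / \<kappa>) powr (1 / (q - p))"
        by (auto simp: eventually_at_filter intro!: always_eventually)
      have "((\<lambda>\<omega>. (1 + \<omega> / \<kappa>) powr (1 / (q - p))) \<longlongrightarrow> (1 + 0 / \<kappa>) powr (1 / (q - p))) (at_right 0)"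
        by (intro tendsto_intros) (use \<kappa>_pos in auto)
      then show "((\<lambda>\<omega>. (1 + \<omega> / \<kappa>) powr (1 / (q - p))) \<longlongrightarrow> 1) (at_right 0)"
        by simp
    qed simp
    \<comment> \<open>A finite slope strictly between \<open>M'0\<close> and 0 also covers the value
      minus infinity.\<close>
    obtain c where c: "M'0 < ereal (- c)" "0 < c"
    proof -
      obtain r where "M'0 < ereal r" "ereal r < 0"
        using ereal_dense2[OF assms(7)] by auto
      then show ?thesis using that[of "- r"] by simp
    qed
    have "\<forall>\<^sub>F \<omega> in at_right 0. ereal (deriv m \<omega>) < ereal (- c) \<and> m differentiable (at \<omega>)"
      using order_tendstoD(2)[OF assms(6) c(1)] assms(5) unfolding m_def[abs_def]
      by (rule eventually_conj)
    then obtain \<delta> where "0 < \<delta>"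
      and \<delta>: "\<And>\<omega>. 0 < \<omega> \<Longrightarrow> \<omega> < \<delta> \<Longrightarrow> deriv m \<omega> < - c \<and> m differentiable (at \<omega>)"
      unfolding eventually_at_right_field by auto
    \<comment> \<open>Differentiability is available only at positive frequencies, so the mean value
      theorem is applied on \<open>[s, \<omega>]\<close>. As \<open>s\<close> tends to 0,
      \<open>upper\<close> and \<open>\<theta>_lim\<close> bound \<open>m s\<close> by
      \<open>m 0\<close> in the limit, in place of continuity of \<open>m\<close> at 0.\<close>
    have decrease: "m \<omega> \<le> m 0 - c * \<omega>" if \<omega>: "0 < \<omega>" "\<omega> < \<delta>" for \<omega>
    proof (rule tendsto_le[OF _ _ tendsto_const])
      have "((\<lambda>s. (\<theta>' s)\<^sup>2 * m 0 - c * (\<omega> - s)) \<longlongrightarrow> 1\<^sup>2 * m 0 - c * (\<omega> - 0)) (at_right 0)"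
        by (intro tendsto_intros \<theta>_lim)
      then show "((\<lambda>s. (\<theta>' s)\<^sup>2 * m 0 - c * (\<omega> - s)) \<longlongrightarrow> m 0 - c * \<omega>) (at_right 0)"
        by simp
      have "m \<omega> \<le> (\<theta>' s)\<^sup>2 * m 0 - c * (\<omega> - s)" if s: "0 < s" "s < \<omega>" for s
      proof -
        have "(m has_real_derivative deriv m x) (at x)" if "s \<le> x" "x \<le> \<omega>" for x
          using \<delta>[of x] that s \<omega>
          by (simp add: DERIV_deriv_iff_real_differentiable)
        then obtain \<xi> where \<xi>: "s < \<xi>" "\<xi> < \<omega>" "m \<omega> - m s = (\<omega> - s) * deriv m \<xi>"
          using MVT2[OF s(2), of m "deriv m"] by blast
        have "(\<omega> - s) * deriv m \<xi> \<le> (\<omega> - s) * (- c)"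
          using \<delta>[of \<xi>] \<xi> s \<omega> by (intro mult_left_mono) auto
        moreover have "m s \<le> (\<theta>' s)\<^sup>2 * m 0"
          using upper[of s] s by simp
        ultimately show ?thesis
          using \<xi>(3) by (simp add: algebra_simps)
      qed
      then show "\<forall>\<^sub>F s in at_right 0. m \<omega> \<le> (\<theta>' s)\<^sup>2 * m 0 - c * (\<omega> - s)"
        unfolding eventually_at_right_field using \<omega>(1) by blast
    qed simp
    \<comment> \<open>\<open>G (\<theta>' \<omega>) \<le> 0\<close> for small \<open>\<omega>\<close>, whereas \<open>G 1 = 0 < G' 1\<close>: the lower bound for the mass is
      constant to first order at \<open>\<theta> = 1\<close>.\<close>
    define G where "G t = (t\<^sup>2 * ((3 - t powr (p - 1)) / 2
          - (5 - p) / (2 * (q - p)) * (t powr (q - 1) - t powr (p - 1))) - 1) * m 0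
          + c * \<kappa> * (t powr (q - 1) - t powr (p - 1))" for t :: real
    have "(G has_real_derivative c * \<kappa> * (q - p)) (at 1)"
    proof -
      define e where "e = (5 - p) / (2 * (q - p))"
      have e: "e * (q - p) = (5 - p) / 2"
        using assms(2) by (simp add: e_def del: right_diff_distrib_numeral)
      have "(G has_real_derivative (2 + (- (p - 1) / 2 - e * ((q - 1) - (p - 1)))) * m 0
          + c * \<kappa> * ((q - 1) - (p - 1))) (at 1)"
        unfolding G_def[abs_def] e_def[symmetric]
        by (auto intro!: derivative_eq_intros simp: field_simps)
      \<comment> \<open>The first-order terms cancel because
        \<open>(p - 1) / 2 + (5 - p) / 2 = 2\<close>.\<close>
      moreover have "2 + (- (p - 1) / 2 - e * ((q - 1) - (p - 1))) = 0"
        using e by (simp add: field_simps)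
      ultimately show ?thesis by simp
    qed
    moreover have "0 < c * \<kappa> * (q - p)"
      using c \<kappa>_pos assms(2) by simp
    ultimately obtain d where "0 < d" and d: "\<And>h. 0 < h \<Longrightarrow> h < d \<Longrightarrow> G 1 < G (1 + h)"
      using DERIV_pos_inc_right by blast
    have "\<forall>\<^sub>F \<omega> in at_right 0. \<theta>' \<omega> < 1 + d"
      using \<theta>_lim \<open>0 < d\<close> by (intro order_tendstoD) auto
    then obtain \<epsilon> where "0 < \<epsilon>" and \<epsilon>: "\<And>\<omega>. 0 < \<omega> \<Longrightarrow> \<omega> < \<epsilon> \<Longrightarrow> \<theta>' \<omega> < 1 + d"
      unfolding eventually_at_right_field by auto
    define \<omega> where "\<omega> = min \<delta> \<epsilon> / 2"
    have \<omega>: "0 < \<omega>" "\<omega> < \<delta>" "\<omega> < \<epsilon>"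
      using \<open>0 < \<delta>\<close> \<open>0 < \<epsilon>\<close> by (auto simp: \<omega>_def)
    \<comment> \<open>The value 1 would force \<open>\<omega> = 0\<close>.\<close>
    have "\<theta>' \<omega> \<noteq> 1"
      using \<omega>_eq[of \<omega>] \<omega>(1) by auto
    with \<theta>_ge[of \<omega>] \<omega>(1) have "1 < \<theta>' \<omega>" by simp
    then have "G 1 < G (\<theta>' \<omega>)"
      using d[of "\<theta>' \<omega> - 1"] \<epsilon>[OF \<omega>(1,3)] by simp
    moreover have "G 1 = 0" by (simp add: G_def)
    moreover have "G (\<theta>' \<omega>) \<le> 0"
    proof -
      have "c * \<kappa> * (\<theta>' \<omega> powr (q - 1) - \<theta>' \<omega> powr (p - 1)) = c * \<omega>"
        using \<omega>_eq[of \<omega>] \<omega>(1) by simp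
      then have "G (\<theta>' \<omega>) = (\<theta>' \<omega>)\<^sup>2 * ((3 - \<theta>' \<omega> powr (p - 1)) / 2
          - (5 - p) / (2 * (q - p)) * (\<theta>' \<omega> powr (q - 1) - \<theta>' \<omega> powr (p - 1))) * m 0 - m 0 + c * \<omega>"
        by (simp only: G_def left_diff_distrib[of _ 1 "m 0"] mult_1_left)
      with lower[of \<omega>] decrease[OF \<omega>(1,2)] \<omega>(1) show ?thesis
        by linarith
    qed
    ultimately show False by simp
  qed
qed

end
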